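(* Let $\alpha,\beta,k>0$, let $T_m\in\mathbb{R}$, let $s_r>0$ be a setpoint, and let $(T(x,t),s(t))$ be a solution of the one-phase Stefan problem $$T_t(x,t)=\alpha T_{xx}(x,t)\ \ (0\le x\le s(t)),\qquad -kT_x(0,t)=q_c(t),\qquad T(s(t),t)=T_m,\qquad \dot s(t)=-\beta T_x(s(t),t),$$ with $T(x,0)=T_0(x)$, $s(0)=s_0$, where $q_c(t)$ is the boundary heat input. Suppose the interface position $Y(t)=s(t)$ is the only available measurement. Consider the observer with state $\hat T(x,t)$, $x\in[0,s(t)]$: $$\hat T_t(x,t)=\alpha\hat T_{xx}(x,t)-P_1(x,s(t))\left(\frac{\dot Y(t)}{\beta}+\hat T_x(s(t),t)\right),$$ $$-k\hat T_x(0,t)=q_c(t),\qquad \hat T(s(t),t)=T_m,$$ where the observer gain is $$P_1(x,s(t))=-\lambda s(t)\,\frac{I_1\!\left(\sqrt{\frac{\lambda}{\alpha}\left(s(t)^2-x^2\right)}\right)}{\sqrt{\frac{\lambda}{\alpha}\left(s(t)^2-x^2\right)}}$$ with gain parameter $\lambda>0$. Assume that the two physical constraints $$q_c(t)>0,\qquad s(t)<s_r,\qquad \forall t>0,$$ are satisfied. Then, for every $\lambda>0$, the observer error system (the system satisfied by $T-\hat T$) is exponentially stable in the sense of the norm $$\|T-\hat T\|_{\mathcal{H}_1}^2 .$$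
   Context: Physical meaning of constants: $\alpha=k/(\rho C_p)$ and $\beta=k/(\rho\Delta H^* )$, with positive constants $\rho$ (density), $C_p$ (heat capacity), $k$ (heat conductivity), $\Delta H^*$ (latent heat of fusion); $T_m$ is the melting temperature. Standing assumption on the initial data of the plant: $s_0>0$ and there is a constant $H>0$ with $0\le T_0(x)-T_m\le H(s_0-x)$ for $x\in[0,s_0]$. Solutions are understood as classical solutions on the moving domain $\{(x,t):0\le x\le s(t),\ t\ge0\}$. $I_1$ is the modified Bessel function of the first kind of order $1$; the quotient $I_1(z)/z$ is extended by its limit $1/2$ at $z=0$. For a function $f(\cdot,t)$ on $[0,s(t)]$, $\|f\|_{\mathcal{H}_1}^2=\int_0^{s(t)}\left(f(x,t)^2+f_x(x,t)^2\right)dx$. Exponential stability in the sense of a (squared) norm $N(t)$ means: there exist constants $M,\kappa>0$, independent of $t$ and of the initial data (they may depend on the physical parameters, the gain and the setpoint), such that $N(t)\le M e^{-\kappa t}N(0)$ for all $t\ge0$. *)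

theory Defs
  imports "HOL-Analysis.Analysis"
begin

definition bessel_I :: "nat \<Rightarrow> real \<Rightarrow> real" where
  "bessel_I n z = (\<Sum>j. (z / 2) ^ (2 * j + n) / (fact j * fact (j + n)))"

definition bessel_I1_quot :: "real \<Rightarrow> real" where
  "bessel_I1_quot z = (if z = 0 then 1 / 2 else bessel_I 1 z / z)"

text \<open>The value \<open>1/2\<close> at the origin is the continuous extension of the quotient.\<close>

lemma isCont_bessel_I1_quot_0: "isCont bessel_I1_quot 0"
proof -
  define a :: "nat \<Rightarrow> real" where "a j = 1 / (2 * 4 ^ j * (fact j * fact (j + 1)))" for j
  have summ: "summable (\<lambda>j. a j * y ^ j)" for y :: real
  proof (rule summable_comparison_test[OF _ summable_norm_exp[of y]], intro exI allI impI)
    fix j :: nat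
    have "1 * fact j \<le> 2 * 4 ^ j * fact (j + 1) * (fact j :: real)"
    proof (rule mult_right_mono)
      have "1 \<le> (4::real) ^ j" "1 \<le> (fact (j + 1) :: real)"
        by (simp, rule fact_ge_1)
      then have "1 * 1 \<le> (4::real) ^ j * fact (j + 1)"
        by (intro mult_mono) auto
      then show "1 \<le> 2 * 4 ^ j * (fact (j + 1) :: real)" by linarith
    qed simp
    then have "a j \<le> inverse (fact j)"
      unfolding a_def inverse_eq_divide by (intro divide_left_mono) (auto simp: mult_ac)
    moreover have "0 \<le> a j" by (simp add: a_def)
    ultimately show "norm (a j * y ^ j) \<le> norm (y ^ j /\<^sub>R fact j)"
      by (simp add: abs_mult power_abs mult_right_mono)
  qed
  define f where "f y = (\<Sum>j. a j * y ^ j)" for y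
  have quot: "bessel_I1_quot = (\<lambda>z. f (z\<^sup>2))"
  proof
    fix z :: real
    show "bessel_I1_quot z = f (z\<^sup>2)"
    proof (cases "z = 0")
      case True
      have "f 0 = a 0" unfolding f_def by simp
      then show ?thesis using True by (simp add: bessel_I1_quot_def a_def)
    next
      case False
      have "(z / 2) ^ (2 * j + 1) / (fact j * fact (j + 1)) = z * (a j * (z\<^sup>2) ^ j)" for j :: nat
      proof -
        have "(z / 2) ^ (2 * j + 1) = z * (z\<^sup>2) ^ j / (2 * 4 ^ j)"
          by (simp add: power_divide power_mult power_add)
        then show ?thesis by (simp add: a_def)
      qed
      then have "bessel_I 1 z = z * f (z\<^sup>2)"
        unfolding bessel_I_def f_def using suminf_mult[OF summ[of "z\<^sup>2"], of z] by simp
      then show ?thesis using False by (simp add: bessel_I1_quot_def)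
    qed
  qed
  have "isCont f 0"
    unfolding f_def by (rule isCont_powser[OF summ[of 1]]) simp
  then show ?thesis
    unfolding quot by (intro isCont_o2[where g = f and f = "\<lambda>z. z\<^sup>2"]) auto
qed

definition observer_gain :: "real \<Rightarrow> real \<Rightarrow> real \<Rightarrow> real \<Rightarrow> real" where
  "observer_gain \<alpha> lam x l = - lam * l * bessel_I1_quot (sqrt (lam / \<alpha> * (l\<^sup>2 - x\<^sup>2)))"

definition moving_domain :: "(real \<Rightarrow> real) \<Rightarrow> (real \<times> real) set" where
  "moving_domain s = {(x, t). 0 \<le> t \<and> 0 \<le> x \<and> x \<le> s t}"

text \<open>
  \<open>classical_on s u ux uxx ut\<close>: on the moving domain, \<open>u\<close> has the partial derivatives
  \<open>ux\<close>, \<open>uxx\<close> (in space) and \<open>ut\<close> (in time). Values of \<open>u\<close> outside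
  the domain are irrelevant, so every derivative is taken within the corresponding slice of the domain
  (one-sided at the fixed boundary and at the interface). \<open>u\<close> and \<open>ux\<close> are
  continuous up to the initial time, which is what gives the initial \<open>H\<^sup>1\<close> norm its
  meaning; the derivatives occurring in the differential equation are only required for positive times.
\<close>

definition classical_on ::
  "(real \<Rightarrow> real) \<Rightarrow> (real \<Rightarrow> real \<Rightarrow> real) \<Rightarrow> (real \<Rightarrow> real \<Rightarrow> real) \<Rightarrow>
   (real \<Rightarrow> real \<Rightarrow> real) \<Rightarrow> (real \<Rightarrow> real \<Rightarrow> real) \<Rightarrow> bool" where
  "classical_on s u ux uxx ut \<longleftrightarrow>
     continuous_on (moving_domain s) (\<lambda>(x, t). u x t) \<and>
     continuous_on (moving_domain s) (\<lambda>(x, t). ux x t) \<and>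
     continuous_on (moving_domain s \<inter> {(x, t). 0 < t}) (\<lambda>(x, t). uxx x t) \<and>
     continuous_on (moving_domain s \<inter> {(x, t). 0 < t}) (\<lambda>(x, t). ut x t) \<and>
     (\<forall>t\<ge>0. \<forall>x\<in>{0..s t}.
        ((\<lambda>y. u y t) has_real_derivative ux x t) (at x within {0..s t})) \<and>
     (\<forall>t>0. \<forall>x\<in>{0..s t}.
        ((\<lambda>y. ux y t) has_real_derivative uxx x t) (at x within {0..s t}) \<and>
        ((\<lambda>\<tau>. u x \<tau>) has_real_derivative ut x t) (at t within {\<tau>. (x, \<tau>) \<in> moving_domain s}))"

definition stefan_solution ::
  "real \<Rightarrow> real \<Rightarrow> real \<Rightarrow> real \<Rightarrow> (real \<Rightarrow> real) \<Rightarrow> (real \<Rightarrow> real) \<Rightarrow> real \<Rightarrow>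
   (real \<Rightarrow> real \<Rightarrow> real) \<Rightarrow> (real \<Rightarrow> real \<Rightarrow> real) \<Rightarrow> (real \<Rightarrow> real \<Rightarrow> real) \<Rightarrow>
   (real \<Rightarrow> real \<Rightarrow> real) \<Rightarrow> (real \<Rightarrow> real) \<Rightarrow> (real \<Rightarrow> real) \<Rightarrow> bool" where
  "stefan_solution \<alpha> \<beta> k Tm qc T0 s0 T Tx Txx Tt s s' \<longleftrightarrow>
     classical_on s T Tx Txx Tt \<and>
     continuous_on {0..} s \<and>
     (\<forall>t>0. (s has_real_derivative s' t) (at t)) \<and>
     (\<forall>t>0. \<forall>x\<in>{0..s t}. Tt x t = \<alpha> * Txx x t) \<and>
     (\<forall>t>0. - k * Tx 0 t = qc t) \<and>
     (\<forall>t>0. T (s t) t = Tm) \<and>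
     (\<forall>t>0. s' t = - \<beta> * Tx (s t) t) \<and>
     (\<forall>x\<in>{0..s0}. T x 0 = T0 x) \<and>
     s 0 = s0"

text \<open>
  The observer sees the plant only through the heat input \<open>qc\<close>, the measurement \<open>Y\<close>
  and its time derivative \<open>Y'\<close>. Its initial state is free.
\<close>

definition observer_solution ::
  "real \<Rightarrow> real \<Rightarrow> real \<Rightarrow> real \<Rightarrow> real \<Rightarrow> (real \<Rightarrow> real) \<Rightarrow> (real \<Rightarrow> real) \<Rightarrow> (real \<Rightarrow> real) \<Rightarrow>
   (real \<Rightarrow> real \<Rightarrow> real) \<Rightarrow> (real \<Rightarrow> real \<Rightarrow> real) \<Rightarrow> (real \<Rightarrow> real \<Rightarrow> real) \<Rightarrow>
   (real \<Rightarrow> real \<Rightarrow> real) \<Rightarrow> bool" where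
  "observer_solution \<alpha> \<beta> k Tm lam qc Y Y' U Ux Uxx Ut \<longleftrightarrow>
     classical_on Y U Ux Uxx Ut \<and>
     (\<forall>t>0. \<forall>x\<in>{0..Y t}.
        Ut x t = \<alpha> * Uxx x t - observer_gain \<alpha> lam x (Y t) * (Y' t / \<beta> + Ux (Y t) t)) \<and>
     (\<forall>t>0. - k * Ux 0 t = qc t) \<and>
     (\<forall>t>0. U (Y t) t = Tm)"

definition H1_norm_sq :: "real \<Rightarrow> (real \<Rightarrow> real) \<Rightarrow> real" where
  "H1_norm_sq l f =
     integral {0..l} (\<lambda>x. (f x)\<^sup>2 + (vector_derivative f (at x within {0..l}))\<^sup>2)"

end

theory Submission
  imports Defs
begin

text \<open>
  The error \<open>u = T - That\<close> satisfies \<open>u\<^sub>t = \<alpha> u\<^sub>x\<^sub>x - P\<^sub>1(x, s) u\<^sub>x(s, t)\<close> with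
  \<open>u\<^sub>x(0, t) = 0\<close> and \<open>u(s, t) = 0\<close>. Backstepping removes the nonlocal term: for a suitable
  Volterra kernel \<open>q\<close>, the function \<open>w(x) = u(x) - \<integral>\<^sub>x\<^sup>s q(x, y) u(y) dy\<close> solves
  \<open>w\<^sub>t = \<alpha> w\<^sub>x\<^sub>x - \<lambda> w\<close> with the same boundary conditions. Integration by parts on the moving
  interval then shows that \<open>E = \<integral> w\<^sup>2 + w\<^sub>x\<^sup>2\<close> satisfies \<open>E' \<le> - 2 \<lambda> E\<close>: the motion of the
  interface contributes only the term \<open>- s'(t) w\<^sub>x(s, t)\<^sup>2\<close>, and \<open>s' \<ge> 0\<close>. This sign is a maximum
  principle: positive heat input and \<open>T\<^sub>0 \<ge> T\<^sub>m\<close> keep the temperature at or above its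
  interface value \<open>T\<^sub>m\<close>, so \<open>T\<^sub>x(s, t) \<le> 0\<close>. Since \<open>s\<close> stays below the setpoint, the
  kernel and its \<open>x\<close>-derivative are uniformly bounded, hence \<open>E\<close> and the squared \<open>H\<^sup>1\<close> norm of
  \<open>u\<close> are comparable with constants that do not depend on the initial data. The decay rate
  obtained is \<open>2 \<lambda>\<close>.

  The analysis is carried out in the variable \<open>\<xi> = x / s(t)\<close>, on the fixed interval \<open>[0, 1]\<close>.
  Put \<open>\<sigma> = (\<lambda> / \<alpha>) s\<^sup>2\<close> and let \<open>\<phi>\<close> be the entire function with \<open>\<phi>(z\<^sup>2) = I\<^sub>1(z) / z\<close>. The
  rescaled kernel is \<open>K(\<xi>, \<eta>) = \<sigma> \<eta> \<phi>(\<sigma> (\<xi>\<^sup>2 - \<eta>\<^sup>2))\<close>; its argument is negative for \<open>\<xi> < \<eta>\<close>, so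
  this is the Bessel function \<open>J\<^sub>1\<close> in disguise, while the gain \<open>P\<^sub>1\<close> involves \<open>\<phi>\<close> at positive
  arguments. Three facts about \<open>K\<close> make the transformation work. The wave equation
  \<open>bs_kernel_wave_equation\<close> produces the damping \<open>- \<lambda> w\<close>; the homogeneity \<open>bs_kernel_scaling\<close>
  accounts for the time dependence of \<open>\<sigma>\<close>; and the convolution identity
  \<open>bessel_ser_resolvent_identity\<close> says that the gain is \<open>- \<alpha>\<close> times the resolvent of \<open>K\<close>, which cancels the
  boundary value \<open>u\<^sub>x(s, t)\<close>. They are combined in \<open>backstep_target_equation\<close>.

  A classical solution need not have a mixed derivative \<open>w\<^sub>x\<^sub>t\<close>, so \<open>\<integral> w\<^sub>x\<^sup>2\<close> cannot be differentiated under
  the integral sign. Instead the increment of this integral is first integrated by parts in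
  space, which leaves only difference quotients of \<open>w\<close> in time
  (\<open>dirichlet_energy_has_derivative\<close>).
\<close>

section \<open>The Bessel quotient as an entire function\<close>

definition bessel_coeff :: "nat \<Rightarrow> real" where
  "bessel_coeff j = 1 / (2 * 4 ^ j * (fact j * fact (j + 1)))"

text \<open>
  The entire function \<open>\<phi>\<close> with \<open>\<phi>(z\<^sup>2) = I\<^sub>1(z) / z\<close>. At \<open>- z\<^sup>2\<close> its value is \<open>J\<^sub>1(z) / z\<close>, so gain and
  backstepping kernel are values of the same power series.
\<close>

definition bessel_ser :: "real \<Rightarrow> real" where "bessel_ser y = (\<Sum>j. bessel_coeff j * y ^ j)"
definition bessel_ser1 :: "real \<Rightarrow> real" where "bessel_ser1 y = (\<Sum>j. diffs bessel_coeff j * y ^ j)"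
definition bessel_ser2 :: "real \<Rightarrow> real" where "bessel_ser2 y = (\<Sum>j. diffs (diffs bessel_coeff) j * y ^ j)"

lemma summable_bessel_coeff: "summable (\<lambda>j. bessel_coeff j * y ^ j)"
proof (rule summable_comparison_test[OF _ summable_norm_exp[of y]], intro exI allI impI)
  fix j :: nat
  have "1 * fact j \<le> 2 * 4 ^ j * fact (j + 1) * (fact j :: real)"
  proof (rule mult_right_mono)
    have "1 * 1 \<le> (4::real) ^ j * fact (j + 1)"
      by (intro mult_mono fact_ge_1) auto
    then show "1 \<le> 2 * 4 ^ j * (fact (j + 1) :: real)" by linarith
  qed simp
  then have "bessel_coeff j \<le> inverse (fact j)"
    unfolding bessel_coeff_def inverse_eq_divide by (intro divide_left_mono) (auto simp: mult_ac)
  moreover have "0 \<le> bessel_coeff j" by (simp add: bessel_coeff_def)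
  ultimately show "norm (bessel_coeff j * y ^ j) \<le> norm (y ^ j /\<^sub>R fact j)"
    by (simp add: abs_mult power_abs mult_right_mono)
qed

lemma summable_diffs_bessel_coeff: "summable (\<lambda>j. diffs bessel_coeff j * y ^ j)"
  by (rule termdiff_converges_all) (rule summable_bessel_coeff)

lemma summable_diffs2_bessel_coeff: "summable (\<lambda>j. diffs (diffs bessel_coeff) j * y ^ j)"
  by (rule termdiff_converges_all) (rule summable_diffs_bessel_coeff)

lemma bessel_ser_has_derivative [derivative_intros]:
  "(bessel_ser has_real_derivative bessel_ser1 y) (at y)"
  unfolding bessel_ser_def[abs_def] bessel_ser1_def
  by (rule termdiffs_strong_converges_everywhere) (rule summable_bessel_coeff)

lemma bessel_ser1_has_derivative:
  "(bessel_ser1 has_real_derivative bessel_ser2 y) (at y)"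
  unfolding bessel_ser1_def[abs_def] bessel_ser2_def
  by (rule termdiffs_strong_converges_everywhere) (rule summable_diffs_bessel_coeff)

lemma bessel_ser2_has_derivative:
  "(bessel_ser2 has_real_derivative (\<Sum>j. diffs (diffs (diffs bessel_coeff)) j * y ^ j)) (at y)"
  unfolding bessel_ser2_def[abs_def]
  by (rule termdiffs_strong_converges_everywhere) (rule summable_diffs2_bessel_coeff)

lemmas bessel_ser_derivs [derivative_intros] =
  DERIV_chain2[OF bessel_ser_has_derivative] DERIV_chain2[OF bessel_ser1_has_derivative]

lemma continuous_on_bessel_ser [continuous_intros]:
  fixes f :: "'a::t2_space \<Rightarrow> real"
  assumes "continuous_on S f"
  shows "continuous_on S (\<lambda>x. bessel_ser (f x))" "continuous_on S (\<lambda>x. bessel_ser1 (f x))"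
    "continuous_on S (\<lambda>x. bessel_ser2 (f x))"
  using assms
  by (auto intro!: continuous_on_compose2[of UNIV _ S f]
        DERIV_continuous_on[OF has_field_derivative_at_within]
        bessel_ser_has_derivative bessel_ser1_has_derivative bessel_ser2_has_derivative)

lemma bessel_ser_0: "bessel_ser 0 = 1 / 2" and bessel_ser1_0: "bessel_ser1 0 = 1 / 16"
  using powser_zero[of bessel_coeff] powser_zero[of "diffs bessel_coeff"]
  by (simp_all add: bessel_ser_def bessel_ser1_def bessel_coeff_def diffs_def)

text \<open>
  Bessel's equation for \<open>I\<^sub>1\<close>, written in the variable \<open>y = z\<^sup>2\<close>; it amounts to the recursion
  \<open>4 j (j + 1) a\<^sub>j = a\<^sub>j\<^sub>-\<^sub>1\<close> of the coefficients.
\<close>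

lemma bessel_ser_ode: "4 * y * bessel_ser2 y + 8 * bessel_ser1 y = bessel_ser y"
proof -
  have s2: "(\<lambda>j. diffs (diffs bessel_coeff) j * y ^ j) sums bessel_ser2 y"
    unfolding bessel_ser2_def by (rule summable_sums[OF summable_diffs2_bessel_coeff])
  have "(\<lambda>j. y * (diffs (diffs bessel_coeff) j * y ^ j)) sums (y * bessel_ser2 y)"
    by (rule sums_mult[OF s2])
  also have "(\<lambda>j. y * (diffs (diffs bessel_coeff) j * y ^ j)) =
      (\<lambda>j. real (Suc j) * diffs bessel_coeff (Suc j) * y ^ Suc j)"
    by (simp add: diffs_def mult_ac)
  finally have "(\<lambda>j. real j * diffs bessel_coeff j * y ^ j) sums (y * bessel_ser2 y)"
    using sums_Suc_iff[of "\<lambda>j. real j * diffs bessel_coeff j * y ^ j"] by simp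
  moreover have "(\<lambda>j. diffs bessel_coeff j * y ^ j) sums bessel_ser1 y"
    unfolding bessel_ser1_def by (rule summable_sums[OF summable_diffs_bessel_coeff])
  ultimately have "(\<lambda>j. 4 * (real j * diffs bessel_coeff j * y ^ j) + 8 * (diffs bessel_coeff j * y ^ j))
      sums (4 * (y * bessel_ser2 y) + 8 * bessel_ser1 y)"
    by (intro sums_add sums_mult)
  moreover have "4 * (real j * diffs bessel_coeff j * y ^ j) + 8 * (diffs bessel_coeff j * y ^ j)
      = bessel_coeff j * y ^ j" for j
  proof -
    have "4 * (real j + 2) * diffs bessel_coeff j = bessel_coeff j"
      by (simp add: diffs_def bessel_coeff_def divide_simps)
    moreover have "4 * (real j * d * z) + 8 * (d * z) = (4 * (real j + 2) * d) * z" for d z :: real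
      by (simp add: algebra_simps)
    ultimately show ?thesis by simp
  qed
  ultimately have "(\<lambda>j. bessel_coeff j * y ^ j) sums (4 * (y * bessel_ser2 y) + 8 * bessel_ser1 y)" by simp
  then show ?thesis unfolding bessel_ser_def by (simp add: sums_iff)
qed

lemma bessel_I1_quot_eq_bessel_ser: "bessel_I1_quot z = bessel_ser (z\<^sup>2)"
proof (cases "z = 0")
  case True
  then show ?thesis by (simp add: bessel_I1_quot_def bessel_ser_0)
next
  case False
  have "(z / 2) ^ (2 * j + 1) / (fact j * fact (j + 1)) = z * (bessel_coeff j * (z\<^sup>2) ^ j)" for j :: nat
  proof -
    have "(z / 2) ^ (2 * j + 1) = z * (z\<^sup>2) ^ j / (2 * 4 ^ j)"
      by (simp add: power_divide power_mult power_add)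
    then show ?thesis by (simp add: bessel_coeff_def)
  qed
  then have "bessel_I 1 z = z * bessel_ser (z\<^sup>2)"
    unfolding bessel_I_def bessel_ser_def using suminf_mult[OF summable_bessel_coeff[of "z\<^sup>2"], of z] by simp
  then show ?thesis using False by (simp add: bessel_I1_quot_def)
qed

text \<open>
  The substitution \<open>\<tau> = \<sigma> (y\<^sup>2 - x\<^sup>2)\<close> turns this into the convolution formula
  \<open>\<integral>\<^sub>0\<^sup>V \<phi>(- \<tau>) \<phi>(V - \<tau>) d\<tau> = 2 (\<phi>(V) - \<phi>(- V))\<close>. By Bessel's equation, \<open>p(\<tau>) = \<tau> \<phi>(\<tau>)\<close> satisfies
  \<open>p'' = \<phi> / 4\<close>, and \<open>r(\<tau>) = \<tau> \<phi>(- \<tau>)\<close> satisfies \<open>r''(\<tau>) = - \<phi>(- \<tau>) / 4\<close>. Hence the derivative of the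
  Wronskian-type expression \<open>r'(\<tau>) p(V - \<tau>) + r(\<tau>) p'(V - \<tau>)\<close> is
  \<open>r''(\<tau>) p(V - \<tau>) - r(\<tau>) p''(V - \<tau>) = - (V / 4) \<phi>(- \<tau>) \<phi>(V - \<tau>)\<close>: the integrand has an explicit
  antiderivative.
\<close>

lemma bessel_ser_resolvent_identity:
  assumes "\<sigma> > 0" "0 \<le> x" "x \<le> 1"
  shows "((\<lambda>y. \<sigma> * y * bessel_ser (\<sigma> * (x\<^sup>2 - y\<^sup>2)) * bessel_ser (\<sigma> * (1 - y\<^sup>2)))
    has_integral (bessel_ser (\<sigma> * (1 - x\<^sup>2)) - bessel_ser (- (\<sigma> * (1 - x\<^sup>2))))) {x..1}"
proof (cases "x = 1")
  case True
  then show ?thesis by (simp add: has_integral_refl)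
next
  case False
  define V where "V = \<sigma> * (1 - x\<^sup>2)"
  have "x\<^sup>2 < 1\<^sup>2" using False assms by (intro power_strict_mono) auto
  then have V: "V > 0" using assms by (simp add: V_def)
  define a where "a y = \<sigma> * (x\<^sup>2 - y\<^sup>2)" for y
  define b where "b y = \<sigma> * (1 - y\<^sup>2)" for y
  have ab: "b y = V + a y" for y by (simp add: a_def b_def V_def algebra_simps)
  \<comment> \<open>The antiderivative described above at \<open>\<tau> = - a y\<close>, where \<open>V - \<tau> = b y\<close>.\<close>
  define Z where "Z y = (bessel_ser (a y) + a y * bessel_ser1 (a y)) * (b y * bessel_ser (b y))
    - (a y * bessel_ser (a y)) * (bessel_ser (b y) + b y * bessel_ser1 (b y))" for y
  have da: "(a has_real_derivative (- 2 * \<sigma> * y)) (at y within A)" for y A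
    unfolding a_def by (auto intro!: derivative_eq_intros)
  have db: "(b has_real_derivative (- 2 * \<sigma> * y)) (at y within A)" for y A
    unfolding b_def by (auto intro!: derivative_eq_intros)
  have dZ: "(Z has_real_derivative (- V / 2) * (\<sigma> * y * bessel_ser (a y) * bessel_ser (b y))) (at y within A)" for y A
  proof -
    let ?d = "- 2 * \<sigma> * y"
    have "(Z has_real_derivative
       ?d * ((2 * bessel_ser1 (a y) + a y * bessel_ser2 (a y)) * (b y * bessel_ser (b y))
        - (a y * bessel_ser (a y)) * (2 * bessel_ser1 (b y) + b y * bessel_ser2 (b y)))) (at y within A)"
      unfolding Z_def
      by (rule derivative_eq_intros refl da db | simp)+ (simp add: algebra_simps)
    moreover have "2 * bessel_ser1 z + z * bessel_ser2 z = bessel_ser z / 4" for z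
      using bessel_ser_ode[of z] by simp
    ultimately have "(Z has_real_derivative
       ?d * ((bessel_ser (a y) / 4) * (b y * bessel_ser (b y)) - (a y * bessel_ser (a y)) * (bessel_ser (b y) / 4))) (at y within A)"
      by simp
    also have "?d * ((bessel_ser (a y) / 4) * (b y * bessel_ser (b y)) - (a y * bessel_ser (a y)) * (bessel_ser (b y) / 4))
      = (- V / 2) * (\<sigma> * y * bessel_ser (a y) * bessel_ser (b y))"
      unfolding ab by (simp add: field_simps)
    finally show ?thesis .
  qed
  have "((\<lambda>y. (- V / 2) * (\<sigma> * y * bessel_ser (a y) * bessel_ser (b y))) has_integral (Z 1 - Z x)) {x..1}"
    using assms by (intro fundamental_theorem_of_calculus)
      (simp_all only: dZ flip: has_real_derivative_iff_has_vector_derivative)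
  then have "((\<lambda>y. (- 2 / V) * ((- V / 2) * (\<sigma> * y * bessel_ser (a y) * bessel_ser (b y))))
      has_integral ((- 2 / V) * (Z 1 - Z x))) {x..1}"
    by (rule has_integral_mult_right)
  moreover have "(- 2 / V) * ((- V / 2) * r) = r" for r using V by simp
  moreover have "(- 2 / V) * (Z 1 - Z x) = bessel_ser V - bessel_ser (- V)"
  proof -
    have "a 1 = - V" "b 1 = 0" "a x = 0" "b x = V"
      by (auto simp: a_def b_def V_def algebra_simps)
    then have "Z 1 - Z x = V * bessel_ser (- V) / 2 - V * bessel_ser V / 2"
      by (simp add: Z_def bessel_ser_0)
    then show ?thesis using V by (simp add: field_simps)
  qed
  ultimately have "((\<lambda>y. \<sigma> * y * bessel_ser (a y) * bessel_ser (b y)) has_integral (bessel_ser V - bessel_ser (- V))) {x..1}"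
    by (simp only:)
  then show ?thesis by (simp only: a_def b_def V_def)
qed

section \<open>Integrals with a parameter\<close>

text \<open>
  Hadamard's form of the difference quotient \<open>(f p t - f p t0) / (t - t0)\<close> of a primitive \<open>f p\<close> of
  \<open>f' p\<close>. Unlike the quotient itself it is jointly continuous, also at \<open>t = t0\<close>; this turns limits
  of difference quotients into continuity of parameter integrals.
\<close>

definition hadamard_quot :: "('a \<Rightarrow> real \<Rightarrow> real) \<Rightarrow> real \<Rightarrow> 'a \<Rightarrow> real \<Rightarrow> real" where
  "hadamard_quot f' t0 p t = integral {0..1} (\<lambda>r. f' p (t0 + r * (t - t0)))"

lemma convex_real_segment:
  assumes "convex S" "(t0::real) \<in> S" "t \<in> S" "r \<in> {0..1}"
  shows "t0 + r * (t - t0) \<in> S"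
  using convexD_alt[OF assms(1-3), of r] assms(4) by (simp add: algebra_simps)

lemma hadamard_quot_continuous:
  fixes f' :: "'a::t2_space \<Rightarrow> real \<Rightarrow> real"
  assumes "convex S" "t0 \<in> S"
    and cont: "continuous_on (P \<times> S) (\<lambda>(p, t). f' p t)"
  shows "continuous_on (P \<times> S) (\<lambda>(p, t). hadamard_quot f' t0 p t)"
proof -
  have "continuous_on ((P \<times> S) \<times> cbox 0 1)
      (\<lambda>(z, r). f' (fst z) (t0 + r * (snd z - t0)))"
    unfolding split_beta
    by (rule continuous_on_compose2[OF cont[unfolded split_beta],
          where f = "\<lambda>y. (fst (fst y), t0 + snd y * (snd (fst y) - t0))", simplified])
      (auto intro!: continuous_intros convex_real_segment[OF assms(1,2)])
  from integral_continuous_on_param[OF this] show ?thesis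
    by (simp add: hadamard_quot_def split_beta)
qed

lemma hadamard_quot_at [simp]: "hadamard_quot f' t0 p t0 = f' p t0"
  by (simp add: hadamard_quot_def)

lemma hadamard_quot_eq:
  assumes "convex S" "t0 \<in> S" "t \<in> S"
    and deriv: "\<And>t. t \<in> S \<Longrightarrow> (f p has_real_derivative f' p t) (at t within S)"
  shows "f p t = f p t0 + (t - t0) * hadamard_quot f' t0 p t"
proof -
  have "((\<lambda>r. f p (t0 + r * (t - t0))) has_vector_derivative (t - t0) * f' p (t0 + r * (t - t0)))
      (at r within {0..1})" if "r \<in> {0..1}" for r
  proof -
    have "((f p \<circ> (\<lambda>r. t0 + r * (t - t0))) has_real_derivative f' p (t0 + r * (t - t0)) * (t - t0))
      (at r within {0..1})"
    proof (rule DERIV_image_chain)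
      show "(f p has_real_derivative f' p (t0 + r * (t - t0)))
          (at (t0 + r * (t - t0)) within (\<lambda>r. t0 + r * (t - t0)) ` {0..1})"
        by (rule DERIV_subset[OF deriv])
          (use that convex_real_segment[OF assms(1-3)] in auto)
      show "((\<lambda>r. t0 + r * (t - t0)) has_real_derivative (t - t0)) (at r within {0..1})"
        by (auto intro!: derivative_eq_intros)
    qed
    then show ?thesis
      by (simp add: o_def mult.commute has_real_derivative_iff_has_vector_derivative)
  qed
  from fundamental_theorem_of_calculus[OF _ this]
  have "((\<lambda>r. (t - t0) * f' p (t0 + r * (t - t0))) has_integral (f p t - f p t0)) {0..1}"
    by simp
  then have "integral {0..1} (\<lambda>r. (t - t0) * f' p (t0 + r * (t - t0))) = f p t - f p t0"
    by (rule integral_unique)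
  then show ?thesis by (simp add: hadamard_quot_def)
qed

lemma has_derivative_from_quotient:
  fixes f q :: "real \<Rightarrow> real"
  assumes "t0 \<in> S" "continuous_on S q" "\<And>t. t \<in> S \<Longrightarrow> f t = f t0 + (t - t0) * q t"
  shows "(f has_real_derivative q t0) (at t0 within S)"
proof -
  have "((\<lambda>t. (f t - f t0) / (t - t0)) \<longlongrightarrow> q t0) (at t0 within S)"
  proof (rule Lim_transform_eventually)
    show "(q \<longlongrightarrow> q t0) (at t0 within S)"
      using assms(1,2) by (simp add: continuous_on)
    show "\<forall>\<^sub>F t in at t0 within S. q t = (f t - f t0) / (t - t0)"
      unfolding eventually_at_filter
    proof (rule always_eventually, intro allI impI)
      fix t assume "t \<noteq> t0" "t \<in> S"
      then show "q t = (f t - f t0) / (t - t0)" using assms(3)[of t] by simp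
    qed
  qed
  then show ?thesis by (simp add: has_field_derivative_iff)
qed

text \<open>
  Rescaling \<open>{g p..1}\<close> to the unit interval moves the variable end point into the integrand.
\<close>

lemma continuous_on_tail_integral:
  fixes F :: "'a::t2_space \<Rightarrow> real \<Rightarrow> real"
  assumes cont: "continuous_on (S \<times> {0..1}) (\<lambda>(p, y). F p y)"
    and g: "continuous_on S g" "\<And>p. p \<in> S \<Longrightarrow> g p \<in> {0..1}"
  shows "continuous_on S (\<lambda>p. integral {g p..1} (F p))"
proof -
  have *: "integral {g p..1} (F p) = integral {0..1} (\<lambda>r. (1 - g p) * F p (g p + r * (1 - g p)))"
    if "p \<in> S" for p
  proof -
    have gp: "0 \<le> g p" "g p \<le> 1" using g(2)[OF that] by auto
    have img: "g p + r * (1 - g p) \<in> {0..1}" if "r \<in> {0..1}" for r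
      by (rule convex_real_segment) (use gp that in auto)
    have "continuous_on {0..1} (F p)"
      by (rule continuous_on_compose2[OF cont[unfolded split_beta],
          where f = "\<lambda>y. (p, y)", simplified]) (auto intro!: continuous_intros simp: that)
    then have "((\<lambda>r. (1 - g p) *\<^sub>R F p (g p + r * (1 - g p))) has_integral
        integral {g p + 0 * (1 - g p)..g p + 1 * (1 - g p)} (F p)) {0..1}"
      using gp img
      by (intro has_integral_substitution[where c = 0 and d = 1])
        (auto intro!: derivative_eq_intros)
    from integral_unique[OF this] show ?thesis by simp
  qed
  have gs: "continuous_on (S \<times> cbox 0 (1::real)) (\<lambda>z. g (fst z))"
    by (rule continuous_on_compose2[OF g(1)]) (auto intro!: continuous_intros)
  have "g p + r * (1 - g p) \<in> {0..1}" if "p \<in> S" "r \<in> {0..1}" for p r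
    by (rule convex_real_segment[OF _ g(2)[OF that(1)] _ that(2)]) auto
  then have "continuous_on (S \<times> cbox 0 1) (\<lambda>z. F (fst z) (g (fst z) + snd z * (1 - g (fst z))))"
    by (intro continuous_on_compose2[OF cont[unfolded split_beta],
          where f = "\<lambda>z. (fst z, g (fst z) + snd z * (1 - g (fst z)))", simplified])
      (use gs[unfolded cbox_interval] in \<open>auto intro!: continuous_intros\<close>)
  then have "continuous_on (S \<times> cbox 0 1) (\<lambda>(p, r). (1 - g p) * F p (g p + r * (1 - g p)))"
    unfolding split_beta by (intro continuous_intros gs)
  from integral_continuous_on_param[OF this]
  have "continuous_on S (\<lambda>p. integral {0..1} (\<lambda>r. (1 - g p) * F p (g p + r * (1 - g p))))"
    by simp
  then show ?thesis using * by (simp cong: continuous_on_cong)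
qed

text \<open>
  Leibniz' rule with a moving lower end point. The increment splits into
  \<open>\<integral>\<^sub>x\<^sup>1 (F(x, y) - F(x0, y)) dy\<close>, whose quotient by \<open>x - x0\<close> is a tail integral of a Hadamard quotient
  and therefore continuous, and the increment of \<open>\<integral>\<^sub>x\<^sup>1 F(x0, y) dy\<close>.
\<close>

lemma tail_integral_has_derivative:
  fixes F F1 :: "real \<Rightarrow> real \<Rightarrow> real"
  assumes x0: "x0 \<in> {0..1}"
    and contF: "continuous_on ({0..1} \<times> {0..1}) (\<lambda>(x, y). F x y)"
    and contF1: "continuous_on ({0..1} \<times> {0..1}) (\<lambda>(x, y). F1 x y)"
    and deriv: "\<And>x y. x \<in> {0..1} \<Longrightarrow> y \<in> {0..1} \<Longrightarrow>
      ((\<lambda>x. F x y) has_real_derivative F1 x y) (at x within {0..1})"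
  shows "((\<lambda>x. integral {x..1} (F x)) has_real_derivative
      (integral {x0..1} (F1 x0) - F x0 x0)) (at x0 within {0..1})"
proof -
  let ?q = "\<lambda>x y. hadamard_quot (\<lambda>y x. F1 x y) x0 y x"
  have contF1': "continuous_on ({0..1} \<times> {0..1}) (\<lambda>(y, x). F1 x y)"
    unfolding split_beta
    by (rule continuous_on_compose2[OF contF1[unfolded split_beta],
          where f = "\<lambda>z. (snd z, fst z)", simplified]) (auto intro!: continuous_intros)
  have contq: "continuous_on ({0..1} \<times> {0..1}) (\<lambda>(y, x). hadamard_quot (\<lambda>y x. F1 x y) x0 y x)"
    by (rule hadamard_quot_continuous[OF _ _ contF1']) (use x0 in auto)
  have contq': "continuous_on ({0..1} \<times> {0..1}) (\<lambda>(x, y). ?q x y)"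
    unfolding split_beta
    by (rule continuous_on_compose2[OF contq[unfolded split_beta],
          where f = "\<lambda>z. (snd z, fst z)", simplified]) (auto intro!: continuous_intros)
  have sec: "continuous_on {0..1} (G x)" if "x \<in> {0..1}"
    "continuous_on ({0..1} \<times> {0..1}) (\<lambda>(x, y). G x y)" for x and G :: "real \<Rightarrow> real \<Rightarrow> real"
    by (rule continuous_on_compose2[OF that(2)[unfolded split_beta],
          where f = "\<lambda>y. (x, y)", simplified]) (use that(1) in \<open>auto intro!: continuous_intros\<close>)
  have int: "G x integrable_on {x..1}" if "x \<in> {0..1}"
    "continuous_on ({0..1} \<times> {0..1}) (\<lambda>(x, y). G x y)" for x and G :: "real \<Rightarrow> real \<Rightarrow> real"
    by (rule integrable_continuous_real, rule continuous_on_subset[OF sec[OF that]])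
      (use that in auto)
  have F_eq: "F x y = F x0 y + (x - x0) * ?q x y" if "x \<in> {0..1}" "y \<in> {0..1}" for x y
    by (rule hadamard_quot_eq[where f = "\<lambda>y x. F x y" and S = "{0..1}"])
      (use that x0 deriv in auto)
  have split: "integral {x..1} (F x) = integral {x..1} (F x0) + (x - x0) * integral {x..1} (?q x)"
    if x: "x \<in> {0..1}" for x
  proof -
    have i0: "F x0 integrable_on {x..1}"
      by (rule integrable_continuous_real, rule continuous_on_subset[OF sec[OF x0 contF]])
        (use x in auto)
    have "integral {x..1} (F x) = integral {x..1} (\<lambda>y. F x0 y + (x - x0) * ?q x y)"
      by (rule integral_cong) (use F_eq x in auto)
    also have "\<dots> = integral {x..1} (F x0) + integral {x..1} (\<lambda>y. (x - x0) * ?q x y)"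
      by (intro integral_add i0 integrable_on_mult_right int[OF x contq'])
    finally show ?thesis by simp
  qed
  have d1: "((\<lambda>x. integral {x..1} (F x0)) has_real_derivative - F x0 x0) (at x0 within {0..1})"
    using integral_has_real_derivative'[OF sec[OF x0 contF] x0] .
  have "((\<lambda>x. (x - x0) * integral {x..1} (?q x)) has_real_derivative integral {x0..1} (?q x0))
      (at x0 within {0..1})"
    by (rule has_derivative_from_quotient)
      (use x0 in \<open>auto intro!: continuous_on_tail_integral[OF contq'] continuous_intros\<close>)
  from DERIV_add[OF d1 this]
  have "((\<lambda>x. integral {x..1} (F x0) + (x - x0) * integral {x..1} (?q x)) has_real_derivative
      (integral {x0..1} (F1 x0) - F x0 x0)) (at x0 within {0..1})"
    by (simp add: algebra_simps)
  then show ?thesis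
    by (rule has_field_derivative_transform_within[OF _ zero_less_one x0]) (simp add: split)
qed

lemma continuous_on_section:
  assumes "continuous_on (A \<times> B) (\<lambda>(x, y). G x y)"
  shows "x \<in> A \<Longrightarrow> continuous_on B (G x)" "y \<in> B \<Longrightarrow> continuous_on A (\<lambda>x. G x y)"
  using assms
  by (auto intro!: continuous_intros
      continuous_on_compose2[OF assms[unfolded split_beta], where f = "\<lambda>y. (x, y)", simplified]
      continuous_on_compose2[OF assms[unfolded split_beta], where f = "\<lambda>x. (x, y)", simplified])

lemma integral_by_parts_real:
  fixes f g f' g' :: "real \<Rightarrow> real"
  assumes "a \<le> b"
    and "\<And>x. x \<in> {a..b} \<Longrightarrow> (f has_real_derivative f' x) (at x within {a..b})"
    and "\<And>x. x \<in> {a..b} \<Longrightarrow> (g has_real_derivative g' x) (at x within {a..b})"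
    and "continuous_on {a..b} f'" "continuous_on {a..b} g'"
  shows "integral {a..b} (\<lambda>x. f x * g' x) = f b * g b - f a * g a - integral {a..b} (\<lambda>x. f' x * g x)"
proof -
  have cf: "continuous_on {a..b} f" "continuous_on {a..b} g"
    by (rule DERIV_continuous_on, rule assms(2), assumption)
      (rule DERIV_continuous_on, rule assms(3), assumption)
  have "((\<lambda>x. f x * g' x + f' x * g x) has_integral (f b * g b - f a * g a)) {a..b}"
    by (rule fundamental_theorem_of_calculus[OF assms(1)])
      (auto intro!: derivative_eq_intros assms(2,3)
        simp flip: has_real_derivative_iff_has_vector_derivative simp: algebra_simps)
  then have "integral {a..b} (\<lambda>x. f x * g' x + f' x * g x) = f b * g b - f a * g a"
    by (rule integral_unique)
  moreover have "integral {a..b} (\<lambda>x. f x * g' x + f' x * g x)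
     = integral {a..b} (\<lambda>x. f x * g' x) + integral {a..b} (\<lambda>x. f' x * g x)"
    by (intro integral_add integrable_continuous_real continuous_intros cf assms)
  ultimately show ?thesis by simp
qed

text \<open>
  Sums of two terms are covered by a vanishing third term \<open>0 * 0\<close>.
\<close>

lemma integral_linear_combination3:
  fixes f g h :: "real \<Rightarrow> real"
  assumes "continuous_on {a..b} f" "continuous_on {a..b} g" "continuous_on {a..b} h"
  shows "integral {a..b} (\<lambda>x. p * f x + q * g x + r * h x)
    = p * integral {a..b} f + q * integral {a..b} g + r * integral {a..b} h"
proof -
  have "((\<lambda>x. p * f x + q * g x + r * h x) has_integral
      (p * integral {a..b} f + q * integral {a..b} g + r * integral {a..b} h)) {a..b}"
    by (intro has_integral_add has_integral_mult_right integrable_integral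
        integrable_continuous_real assms)
  then show ?thesis by (rule integral_unique)
qed

text \<open>
  The formula that one obtains formally by exchanging derivatives, valid without any mixed
  derivative of \<open>w\<close>. Writing \<open>a\<^sup>2 - b\<^sup>2 = (a + b) (a - b)\<close> and integrating by parts,
  the increment of the energy between \<open>t0\<close> and \<open>t\<close> is
  \<open>- \<integral> (w\<^sub>x\<^sub>x(t) + w\<^sub>x\<^sub>x(t0)) (w(t) - w(t0)) dx\<close>; the boundary conditions at times \<open>t0\<close> and \<open>t\<close> annihilate
  the boundary terms. Only a time difference of \<open>w\<close> itself is left.
\<close>

lemma dirichlet_energy_has_derivative:
  fixes w w1 w2 wt :: "real \<Rightarrow> real \<Rightarrow> real"
  assumes S: "open S" "convex S" "t0 \<in> S"
    and dw: "\<And>x t. x \<in> {0..1} \<Longrightarrow> t \<in> S \<Longrightarrow>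
      ((\<lambda>x. w x t) has_real_derivative w1 x t) (at x within {0..1})"
    and dw1: "\<And>x t. x \<in> {0..1} \<Longrightarrow> t \<in> S \<Longrightarrow>
      ((\<lambda>x. w1 x t) has_real_derivative w2 x t) (at x within {0..1})"
    and dwt: "\<And>x t. x \<in> {0..1} \<Longrightarrow> t \<in> S \<Longrightarrow> ((\<lambda>t. w x t) has_real_derivative wt x t) (at t)"
    and c2: "continuous_on ({0..1} \<times> S) (\<lambda>(x, t). w2 x t)"
    and ct: "continuous_on ({0..1} \<times> S) (\<lambda>(x, t). wt x t)"
    and bc: "\<And>t. t \<in> S \<Longrightarrow> w 1 t = 0" "\<And>t. t \<in> S \<Longrightarrow> w1 0 t = 0"
  shows "((\<lambda>t. integral {0..1} (\<lambda>x. (w1 x t)\<^sup>2)) has_real_derivative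
      - 2 * integral {0..1} (\<lambda>x. wt x t0 * w2 x t0)) (at t0)"
proof -
  let ?q = "hadamard_quot wt t0"
  have cq: "continuous_on ({0..1} \<times> S) (\<lambda>(x, t). ?q x t)"
    by (rule hadamard_quot_continuous[OF S(2,3) ct])
  have w_eq: "w x t = w x t0 + (t - t0) * ?q x t" if "x \<in> {0..1}" "t \<in> S" for x t
    by (rule hadamard_quot_eq[where f = w and p = x, OF S(2,3) that(2)])
      (rule has_field_derivative_at_within[OF dwt[OF that(1)]])
  define \<Psi> where "\<Psi> t = - integral {0..1} (\<lambda>x. ?q x t * (w2 x t + w2 x t0))" for t
  have "continuous_on S (\<lambda>t. integral (cbox 0 1) (\<lambda>x. ?q x t * (w2 x t + w2 x t0)))"
  proof (rule integral_continuous_on_param)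
    have sw: "continuous_on (S \<times> cbox 0 1) (\<lambda>z. G (snd z) (fst z))"
      if "continuous_on ({0..1} \<times> S) (\<lambda>(x, t). G x t)" for G :: "real \<Rightarrow> real \<Rightarrow> real"
      by (rule continuous_on_compose2[OF that[unfolded split_beta],
          where f = "\<lambda>z. (snd z, fst z)", simplified]) (auto intro!: continuous_intros)
    have "continuous_on (S \<times> cbox 0 1) (\<lambda>z. w2 (snd z) t0)"
      by (rule continuous_on_compose2[OF continuous_on_section(2)[OF c2 S(3)]])
        (auto intro!: continuous_intros)
    then show "continuous_on (S \<times> cbox 0 1) (\<lambda>(t, x). ?q x t * (w2 x t + w2 x t0))"
      unfolding split_beta by (rule continuous_on_mult[OF sw[OF cq] continuous_on_add[OF sw[OF c2]]])
  qed
  then have c\<Psi>: "continuous_on S \<Psi>" unfolding \<Psi>_def cbox_interval by (rule continuous_on_minus)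
  have c1: "continuous_on {0..1} (\<lambda>x. w1 x t)" if "t \<in> S" for t
    by (rule DERIV_continuous_on) (rule dw1[OF _ that])
  have eq: "integral {0..1} (\<lambda>x. (w1 x t)\<^sup>2) = integral {0..1} (\<lambda>x. (w1 x t0)\<^sup>2) + (t - t0) * \<Psi> t"
    if t: "t \<in> S" for t
  proof -
    have "integral {0..1} (\<lambda>x. (w1 x t)\<^sup>2) - integral {0..1} (\<lambda>x. (w1 x t0)\<^sup>2)
      = integral {0..1} (\<lambda>x. (w1 x t)\<^sup>2 - (w1 x t0)\<^sup>2)"
      by (intro integral_diff[symmetric] integrable_continuous_real continuous_intros c1 t S(3))
    also have "\<dots> = integral {0..1} (\<lambda>x. (w1 x t + w1 x t0) * (w1 x t - w1 x t0))"
      by (simp add: power2_eq_square algebra_simps)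
    also have "\<dots> = - integral {0..1} (\<lambda>x. (w2 x t + w2 x t0) * (w x t - w x t0))"
    proof -
      have "integral {0..1} (\<lambda>x. (w1 x t + w1 x t0) * (w1 x t - w1 x t0))
        = (w1 1 t + w1 1 t0) * (w 1 t - w 1 t0) - (w1 0 t + w1 0 t0) * (w 0 t - w 0 t0)
          - integral {0..1} (\<lambda>x. (w2 x t + w2 x t0) * (w x t - w x t0))"
      proof (rule integral_by_parts_real)
        fix x :: real assume x: "x \<in> {0..1}"
        show "((\<lambda>x. w1 x t + w1 x t0) has_real_derivative w2 x t + w2 x t0) (at x within {0..1})"
          by (rule DERIV_add[OF dw1[OF x t] dw1[OF x S(3)]])
        show "((\<lambda>x. w x t - w x t0) has_real_derivative w1 x t - w1 x t0) (at x within {0..1})"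
          by (rule DERIV_diff[OF dw[OF x t] dw[OF x S(3)]])
      qed (rule zero_le_one, rule continuous_on_add[OF continuous_on_section(2)[OF c2 t]
          continuous_on_section(2)[OF c2 S(3)]], rule continuous_on_diff[OF c1[OF t] c1[OF S(3)]])
      then show ?thesis using bc[OF t] bc[OF S(3)] by simp
    qed
    also have "integral {0..1} (\<lambda>x. (w2 x t + w2 x t0) * (w x t - w x t0))
      = integral {0..1} (\<lambda>x. (t - t0) * (?q x t * (w2 x t + w2 x t0)))"
      by (rule integral_cong) (simp add: w_eq[OF _ t])
    finally show ?thesis by (simp add: \<Psi>_def)
  qed
  have "((\<lambda>t. integral {0..1} (\<lambda>x. (w1 x t)\<^sup>2)) has_real_derivative \<Psi> t0) (at t0 within S)"
    by (rule has_derivative_from_quotient[OF S(3) c\<Psi> eq])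
  moreover have "\<Psi> t0 = - 2 * integral {0..1} (\<lambda>x. wt x t0 * w2 x t0)"
    by (simp add: \<Psi>_def algebra_simps)
  ultimately show ?thesis by (simp add: at_within_open[OF S(3,1)])
qed

section \<open>The backstepping transformation\<close>

text \<open>
  The backstepping kernel on the unit interval; in the physical variables it is \<open>s q(s x, s y)\<close>
  with \<open>q(x, y) = c y \<phi>(c (x\<^sup>2 - y\<^sup>2))\<close> and \<open>\<sigma> = c s\<^sup>2\<close>, \<open>c = \<lambda> / \<alpha>\<close>. The suffixes \<open>_x\<close>, \<open>_y\<close>, \<open>_s\<close> denote
  partial derivatives, the last one with respect to \<open>\<sigma>\<close>.
\<close>

definition bs_kernel :: "real \<Rightarrow> real \<Rightarrow> real \<Rightarrow> real" where
  "bs_kernel \<sigma> x y = \<sigma> * y * bessel_ser (\<sigma> * (x\<^sup>2 - y\<^sup>2))"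

definition bs_kernel_x :: "real \<Rightarrow> real \<Rightarrow> real \<Rightarrow> real" where
  "bs_kernel_x \<sigma> x y = 2 * \<sigma>\<^sup>2 * x * y * bessel_ser1 (\<sigma> * (x\<^sup>2 - y\<^sup>2))"

definition bs_kernel_xx :: "real \<Rightarrow> real \<Rightarrow> real \<Rightarrow> real" where
  "bs_kernel_xx \<sigma> x y = 2 * \<sigma>\<^sup>2 * y * bessel_ser1 (\<sigma> * (x\<^sup>2 - y\<^sup>2))
     + 4 * \<sigma> ^ 3 * x\<^sup>2 * y * bessel_ser2 (\<sigma> * (x\<^sup>2 - y\<^sup>2))"

definition bs_kernel_y :: "real \<Rightarrow> real \<Rightarrow> real \<Rightarrow> real" where
  "bs_kernel_y \<sigma> x y = \<sigma> * bessel_ser (\<sigma> * (x\<^sup>2 - y\<^sup>2)) - 2 * \<sigma>\<^sup>2 * y\<^sup>2 * bessel_ser1 (\<sigma> * (x\<^sup>2 - y\<^sup>2))"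

definition bs_kernel_yy :: "real \<Rightarrow> real \<Rightarrow> real \<Rightarrow> real" where
  "bs_kernel_yy \<sigma> x y = - 6 * \<sigma>\<^sup>2 * y * bessel_ser1 (\<sigma> * (x\<^sup>2 - y\<^sup>2))
     + 4 * \<sigma> ^ 3 * y ^ 3 * bessel_ser2 (\<sigma> * (x\<^sup>2 - y\<^sup>2))"

definition bs_kernel_s :: "real \<Rightarrow> real \<Rightarrow> real \<Rightarrow> real" where
  "bs_kernel_s \<sigma> x y = y * bessel_ser (\<sigma> * (x\<^sup>2 - y\<^sup>2))
     + \<sigma> * y * (x\<^sup>2 - y\<^sup>2) * bessel_ser1 (\<sigma> * (x\<^sup>2 - y\<^sup>2))"

lemmas bs_kernel_defs = bs_kernel_def bs_kernel_x_def bs_kernel_xx_def bs_kernel_y_def bs_kernel_yy_def bs_kernel_s_def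

lemma bs_kernel_continuous [continuous_intros]:
  fixes f g h :: "'a::t2_space \<Rightarrow> real"
  assumes "continuous_on S f" "continuous_on S g" "continuous_on S h"
  shows "continuous_on S (\<lambda>z. bs_kernel (f z) (g z) (h z))"
    "continuous_on S (\<lambda>z. bs_kernel_x (f z) (g z) (h z))"
    "continuous_on S (\<lambda>z. bs_kernel_xx (f z) (g z) (h z))"
    "continuous_on S (\<lambda>z. bs_kernel_y (f z) (g z) (h z))"
    "continuous_on S (\<lambda>z. bs_kernel_yy (f z) (g z) (h z))"
    "continuous_on S (\<lambda>z. bs_kernel_s (f z) (g z) (h z))"
  unfolding bs_kernel_defs using assms by (auto intro!: continuous_intros)

lemma bs_kernel_derivs:
  "((\<lambda>x. bs_kernel \<sigma> x y) has_real_derivative bs_kernel_x \<sigma> x y) (at x within A)"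
  "((\<lambda>x. bs_kernel_x \<sigma> x y) has_real_derivative bs_kernel_xx \<sigma> x y) (at x within A)"
  "((\<lambda>y. bs_kernel \<sigma> x y) has_real_derivative bs_kernel_y \<sigma> x y) (at y within A)"
  "((\<lambda>y. bs_kernel_y \<sigma> x y) has_real_derivative bs_kernel_yy \<sigma> x y) (at y within A)"
  "((\<lambda>\<sigma>. bs_kernel \<sigma> x y) has_real_derivative bs_kernel_s \<sigma> x y) (at \<sigma> within A)"
  unfolding bs_kernel_defs
  by (rule derivative_eq_intros refl | simp add: algebra_simps power2_eq_square power3_eq_cube)+

text \<open>
  This is Bessel's equation again; the term \<open>\<sigma> K\<close> is the source of the damping in the target
  system.
\<close>

lemma bs_kernel_wave_equation: "bs_kernel_xx \<sigma> x y = bs_kernel_yy \<sigma> x y + \<sigma> * bs_kernel \<sigma> x y"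
proof -
  define p where "p = \<sigma> * (x\<^sup>2 - y\<^sup>2)"
  have "bs_kernel_xx \<sigma> x y - bs_kernel_yy \<sigma> x y = \<sigma>\<^sup>2 * y * (4 * p * bessel_ser2 p + 8 * bessel_ser1 p)"
    unfolding bs_kernel_defs p_def[symmetric]
    by (simp add: p_def algebra_simps power2_eq_square power3_eq_cube)
  also have "\<dots> = \<sigma> * bs_kernel \<sigma> x y"
    unfolding bessel_ser_ode bs_kernel_def p_def by (simp add: power2_eq_square)
  finally show ?thesis by simp
qed

text \<open>
  Euler's relation: \<open>s q(s x, s y)\<close> depends on \<open>s\<close> through a dilation and one explicit factor. It
  makes the transport term \<open>x (s' / s) w\<^sub>x\<close>, which comes from the moving frame, pass through the
  transformation.
\<close>

lemma bs_kernel_scaling: "2 * \<sigma> * bs_kernel_s \<sigma> x y = bs_kernel \<sigma> x y + y * bs_kernel_y \<sigma> x y + x * bs_kernel_x \<sigma> x y"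
  unfolding bs_kernel_defs by (simp add: algebra_simps power2_eq_square)

lemma bs_kernel_diag:
  "bs_kernel \<sigma> x x = \<sigma> * x / 2" "bs_kernel_x \<sigma> x x = \<sigma>\<^sup>2 * x\<^sup>2 / 8" "bs_kernel_y \<sigma> x x = \<sigma> / 2 - \<sigma>\<^sup>2 * x\<^sup>2 / 8"
  by (simp_all add: bs_kernel_defs bessel_ser_0 bessel_ser1_0 power2_eq_square)

text \<open>
  The backstepping transform of \<open>v\<close>. The functions \<open>backstep1\<close> and \<open>backstep2\<close> are its first two
  derivatives when \<open>v1\<close> and \<open>v2\<close> are those of \<open>v\<close>.
\<close>

definition backstep :: "real \<Rightarrow> (real \<Rightarrow> real) \<Rightarrow> real \<Rightarrow> real" where
  "backstep \<sigma> v x = v x - integral {x..1} (\<lambda>y. bs_kernel \<sigma> x y * v y)"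

definition backstep1 :: "real \<Rightarrow> (real \<Rightarrow> real) \<Rightarrow> (real \<Rightarrow> real) \<Rightarrow> real \<Rightarrow> real" where
  "backstep1 \<sigma> v v1 x = v1 x + \<sigma> * x / 2 * v x - integral {x..1} (\<lambda>y. bs_kernel_x \<sigma> x y * v y)"

definition backstep2 :: "real \<Rightarrow> (real \<Rightarrow> real) \<Rightarrow> (real \<Rightarrow> real) \<Rightarrow> (real \<Rightarrow> real) \<Rightarrow> real \<Rightarrow> real" where
  "backstep2 \<sigma> v v1 v2 x = v2 x + \<sigma> / 2 * v x + \<sigma> * x / 2 * v1 x + \<sigma>\<^sup>2 * x\<^sup>2 / 8 * v x
     - integral {x..1} (\<lambda>y. bs_kernel_xx \<sigma> x y * v y)"

lemma continuous_on_snd_unit: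
  "continuous_on {0..1} (v :: real \<Rightarrow> real) \<Longrightarrow> continuous_on ({0..1::real} \<times> {0..1}) (\<lambda>z. v (snd z))"
  by (rule continuous_on_compose2) (auto intro!: continuous_intros)

lemma backstep_has_derivative:
  assumes x: "x \<in> {0..1}"
    and dv: "\<And>x. x \<in> {0..1} \<Longrightarrow> (v has_real_derivative v1 x) (at x within {0..1})"
  shows "(backstep \<sigma> v has_real_derivative backstep1 \<sigma> v v1 x) (at x within {0..1})"
proof -
  have cv: "continuous_on {0..1} v" by (rule DERIV_continuous_on[OF dv])
  have "((\<lambda>x. integral {x..1} (\<lambda>y. bs_kernel \<sigma> x y * v y)) has_real_derivative
      (integral {x..1} (\<lambda>y. bs_kernel_x \<sigma> x y * v y) - bs_kernel \<sigma> x x * v x)) (at x within {0..1})"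
    by (rule tail_integral_has_derivative[OF x])
      (auto simp: split_beta intro!: continuous_intros continuous_on_snd_unit[OF cv] DERIV_cmult_right bs_kernel_derivs)
  from DERIV_diff[OF dv[OF x] this] show ?thesis
    by (simp add: backstep_def[abs_def] backstep1_def bs_kernel_diag algebra_simps)
qed

lemma backstep1_has_derivative:
  assumes x: "x \<in> {0..1}"
    and dv: "\<And>x. x \<in> {0..1} \<Longrightarrow> (v has_real_derivative v1 x) (at x within {0..1})"
    and dv1: "\<And>x. x \<in> {0..1} \<Longrightarrow> (v1 has_real_derivative v2 x) (at x within {0..1})"
  shows "(backstep1 \<sigma> v v1 has_real_derivative backstep2 \<sigma> v v1 v2 x) (at x within {0..1})"
proof -
  have cv: "continuous_on {0..1} v" by (rule DERIV_continuous_on[OF dv])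
  have "((\<lambda>x. integral {x..1} (\<lambda>y. bs_kernel_x \<sigma> x y * v y)) has_real_derivative
      (integral {x..1} (\<lambda>y. bs_kernel_xx \<sigma> x y * v y) - bs_kernel_x \<sigma> x x * v x)) (at x within {0..1})"
    by (rule tail_integral_has_derivative[OF x])
      (auto simp: split_beta intro!: continuous_intros continuous_on_snd_unit[OF cv] DERIV_cmult_right bs_kernel_derivs)
  moreover have "((\<lambda>x. v1 x + \<sigma> * x / 2 * v x) has_real_derivative
      (v2 x + (\<sigma> / 2 * v x + \<sigma> * x / 2 * v1 x))) (at x within {0..1})"
    using DERIV_add[OF dv1[OF x] DERIV_mult[OF DERIV_cmult[OF DERIV_ident, of "\<sigma> / 2"] dv[OF x]]]
    by (simp add: algebra_simps)
  ultimately show ?thesis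
    unfolding backstep1_def[abs_def] backstep2_def
    by (auto simp: bs_kernel_diag algebra_simps dest: DERIV_diff)
qed

text \<open>
  If \<open>v\<^sub>t = G\<close>, the left-hand side is the time derivative of the transform. Both \<open>\<integral> K v\<^sub>x\<^sub>x\<close> and
  \<open>\<integral> y K v\<^sub>x\<close> are integrated by parts until only \<open>v\<close> remains under the integral. The remaining integrals
  match by the wave equation and the scaling relation, the terms in \<open>v(x)\<close> by the values of \<open>K\<close> on
  the diagonal, and the coefficient of \<open>v\<^sub>x(1)\<close> vanishes by the resolvent identity.
\<close>

lemma backstep_target_equation:
  fixes v v1 v2 :: "real \<Rightarrow> real" and \<sigma> lam b :: real
  assumes \<sigma>: "\<sigma> > 0" and x: "x \<in> {0..1}"
    and dv: "\<And>x. x \<in> {0..1} \<Longrightarrow> (v has_real_derivative v1 x) (at x within {0..1})"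
    and dv1: "\<And>x. x \<in> {0..1} \<Longrightarrow> (v1 has_real_derivative v2 x) (at x within {0..1})"
    and cv2: "continuous_on {0..1} v2"
    and v_1: "v 1 = 0"
  defines "G \<equiv> \<lambda>x. lam / \<sigma> * v2 x + x * b * v1 x + lam * bessel_ser (\<sigma> * (1 - x\<^sup>2)) * v1 1"
  shows "G x - integral {x..1} (\<lambda>y. 2 * b * \<sigma> * bs_kernel_s \<sigma> x y * v y + bs_kernel \<sigma> x y * G y)
    = lam / \<sigma> * backstep2 \<sigma> v v1 v2 x + x * b * backstep1 \<sigma> v v1 x - lam * backstep \<sigma> v x"
proof -
  let ?I = "\<lambda>f. integral {x..1} f"
  have sub: "{x..1} \<subseteq> {0..1}" and x1: "x \<le> 1" using x by auto
  have d: "(v has_real_derivative v1 y) (at y within {x..1})"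
    "(v1 has_real_derivative v2 y) (at y within {x..1})" if "y \<in> {x..1}" for y
    using that sub by (auto intro: DERIV_subset[OF dv sub] DERIV_subset[OF dv1 sub])
  have cv: "continuous_on {x..1} v" "continuous_on {x..1} v1" "continuous_on {x..1} v2"
    using DERIV_continuous_on[OF dv] DERIV_continuous_on[OF dv1] cv2 sub
    by (auto intro: continuous_on_subset)
  note ci = integrable_continuous_real continuous_intros cv
  define A where "A = ?I (\<lambda>y. bs_kernel_yy \<sigma> x y * v y)"
  define B where "B = ?I (\<lambda>y. bs_kernel \<sigma> x y * v y)"
  define C where "C = ?I (\<lambda>y. y * bs_kernel_y \<sigma> x y * v y)"
  define D where "D = ?I (\<lambda>y. bs_kernel_x \<sigma> x y * v y)"
  have i1: "?I (\<lambda>y. bs_kernel \<sigma> x y * v2 y)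
      = bs_kernel \<sigma> x 1 * v1 1 - \<sigma> * x / 2 * v1 x - ?I (\<lambda>y. bs_kernel_y \<sigma> x y * v1 y)"
    by (subst integral_by_parts_real[OF x1 bs_kernel_derivs(3) d(2)])
      (auto intro!: ci simp: bs_kernel_diag)
  have i2: "?I (\<lambda>y. bs_kernel_y \<sigma> x y * v1 y) = - (\<sigma> / 2 - \<sigma>\<^sup>2 * x\<^sup>2 / 8) * v x - A"
    unfolding A_def
    by (subst integral_by_parts_real[OF x1 bs_kernel_derivs(4) d(1)])
      (auto intro!: ci simp: bs_kernel_diag v_1 algebra_simps)
  have i3: "?I (\<lambda>y. y * bs_kernel \<sigma> x y * v1 y) = - (\<sigma> * x\<^sup>2 / 2 * v x) - (B + C)"
  proof -
    have "?I (\<lambda>y. y * bs_kernel \<sigma> x y * v1 y) = 1 * bs_kernel \<sigma> x 1 * v 1 - x * bs_kernel \<sigma> x x * v x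
        - ?I (\<lambda>y. (1 * bs_kernel \<sigma> x y + bs_kernel_y \<sigma> x y * y) * v y)"
      by (rule integral_by_parts_real[OF x1 DERIV_mult[OF DERIV_ident bs_kernel_derivs(3)] d(1)])
        (auto intro!: ci)
    also have "?I (\<lambda>y. (1 * bs_kernel \<sigma> x y + bs_kernel_y \<sigma> x y * y) * v y)
        = ?I (\<lambda>y. bs_kernel \<sigma> x y * v y + y * bs_kernel_y \<sigma> x y * v y)"
      by (simp add: algebra_simps)
    also have "\<dots> = B + C"
      unfolding B_def C_def by (intro integral_add ci)
    finally show ?thesis by (simp add: v_1 bs_kernel_diag power2_eq_square)
  qed
  have i4: "?I (\<lambda>y. bs_kernel \<sigma> x y * bessel_ser (\<sigma> * (1 - y\<^sup>2))) = bessel_ser (\<sigma> * (1 - x\<^sup>2)) - bessel_ser (- (\<sigma> * (1 - x\<^sup>2)))"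
    using integral_unique[OF bessel_ser_resolvent_identity[OF \<sigma>, of x]] x by (simp add: bs_kernel_def)
  have i5: "?I (\<lambda>y. 2 * b * \<sigma> * bs_kernel_s \<sigma> x y * v y) = b * (B + C + x * D)"
  proof -
    have "2 * b * \<sigma> * bs_kernel_s \<sigma> x y * v y
      = b * (bs_kernel \<sigma> x y * v y + y * bs_kernel_y \<sigma> x y * v y + x * (bs_kernel_x \<sigma> x y * v y))" for y
    proof -
      have "2 * b * \<sigma> * bs_kernel_s \<sigma> x y * v y = b * v y * (2 * \<sigma> * bs_kernel_s \<sigma> x y)" by simp
      then show ?thesis unfolding bs_kernel_scaling by (simp add: algebra_simps)
    qed
    then have "?I (\<lambda>y. 2 * b * \<sigma> * bs_kernel_s \<sigma> x y * v y) =
      ?I (\<lambda>y. b * (bs_kernel \<sigma> x y * v y) + b * (y * bs_kernel_y \<sigma> x y * v y) + (b * x) * (bs_kernel_x \<sigma> x y * v y))"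
      by (simp only: distrib_left mult.assoc)
    also have "\<dots> = b * B + b * C + (b * x) * D"
      unfolding B_def C_def D_def by (rule integral_linear_combination3; intro ci)
    finally show ?thesis by (simp add: algebra_simps)
  qed
  have i6: "?I (\<lambda>y. bs_kernel_xx \<sigma> x y * v y) = A + \<sigma> * B"
  proof -
    have "?I (\<lambda>y. bs_kernel_xx \<sigma> x y * v y) = ?I (\<lambda>y. bs_kernel_yy \<sigma> x y * v y + \<sigma> * (bs_kernel \<sigma> x y * v y))"
      by (simp add: bs_kernel_wave_equation algebra_simps)
    also have "\<dots> = A + ?I (\<lambda>y. \<sigma> * (bs_kernel \<sigma> x y * v y))"
      unfolding A_def by (intro integral_add ci)
    finally show ?thesis by (simp add: B_def)
  qed
  have i7: "?I (\<lambda>y. bs_kernel \<sigma> x y * G y)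
      = lam / \<sigma> * ?I (\<lambda>y. bs_kernel \<sigma> x y * v2 y) + b * ?I (\<lambda>y. y * bs_kernel \<sigma> x y * v1 y)
        + lam * v1 1 * ?I (\<lambda>y. bs_kernel \<sigma> x y * bessel_ser (\<sigma> * (1 - y\<^sup>2)))"
  proof -
    have "?I (\<lambda>y. bs_kernel \<sigma> x y * G y) = ?I (\<lambda>y. lam / \<sigma> * (bs_kernel \<sigma> x y * v2 y)
        + b * (y * bs_kernel \<sigma> x y * v1 y) + lam * v1 1 * (bs_kernel \<sigma> x y * bessel_ser (\<sigma> * (1 - y\<^sup>2))))"
      by (rule integral_cong) (simp add: G_def algebra_simps)
    also have "\<dots> = lam / \<sigma> * ?I (\<lambda>y. bs_kernel \<sigma> x y * v2 y) + b * ?I (\<lambda>y. y * bs_kernel \<sigma> x y * v1 y)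
        + lam * v1 1 * ?I (\<lambda>y. bs_kernel \<sigma> x y * bessel_ser (\<sigma> * (1 - y\<^sup>2)))"
      by (rule integral_linear_combination3; intro ci)
    finally show ?thesis .
  qed
  have cG: "continuous_on {x..1} G" unfolding G_def by (intro ci)
  have "?I (\<lambda>y. 2 * b * \<sigma> * bs_kernel_s \<sigma> x y * v y + bs_kernel \<sigma> x y * G y)
    = ?I (\<lambda>y. 2 * b * \<sigma> * bs_kernel_s \<sigma> x y * v y) + ?I (\<lambda>y. bs_kernel \<sigma> x y * G y)"
    by (intro integral_add ci cG)
  also have "\<dots> = b * (B + C + x * D)
     + (lam / \<sigma> * (bs_kernel \<sigma> x 1 * v1 1 - \<sigma> * x / 2 * v1 x - (- (\<sigma> / 2 - \<sigma>\<^sup>2 * x\<^sup>2 / 8) * v x - A))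
       + b * (- (\<sigma> * x\<^sup>2 / 2 * v x) - (B + C))
       + lam * v1 1 * (bessel_ser (\<sigma> * (1 - x\<^sup>2)) - bessel_ser (- (\<sigma> * (1 - x\<^sup>2)))))"
    unfolding i5 i7 i1 i2 i3 i4 ..
  finally have *: "?I (\<lambda>y. 2 * b * \<sigma> * bs_kernel_s \<sigma> x y * v y + bs_kernel \<sigma> x y * G y) = \<dots>" .
  have k1: "bs_kernel \<sigma> x 1 = \<sigma> * bessel_ser (- (\<sigma> * (1 - x\<^sup>2)))"
    by (simp add: bs_kernel_def algebra_simps)
  show ?thesis
    unfolding *
    unfolding backstep2_def backstep1_def backstep_def i6 B_def[symmetric] D_def[symmetric] G_def k1
    using \<sigma> by (simp add: field_simps power2_eq_square)
qed

text \<open>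
  Stated for a general kernel \<open>k\<close> in order to cover the transform and both its derivatives.
\<close>

lemma backstep_kernel_continuous:
  fixes k :: "real \<Rightarrow> real \<Rightarrow> real \<Rightarrow> real" and u :: "real \<Rightarrow> real \<Rightarrow> real" and \<sigma> :: "real \<Rightarrow> real"
  assumes u: "continuous_on ({0..1} \<times> T) (\<lambda>(x, t). u x t)"
    and \<sigma>: "continuous_on T \<sigma>"
    and k: "\<And>f g h. continuous_on (({0..1} \<times> T) \<times> {0..1}) f \<Longrightarrow> continuous_on (({0..1} \<times> T) \<times> {0..1}) g
      \<Longrightarrow> continuous_on (({0..1} \<times> T) \<times> {0..1}) h
      \<Longrightarrow> continuous_on (({0..1} \<times> T) \<times> {0..1}) (\<lambda>z :: (real \<times> real) \<times> real. k (f z) (g z) (h z))"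
  shows "continuous_on ({0..1} \<times> T) (\<lambda>(x, t). integral {x..1} (\<lambda>y. k (\<sigma> t) x y * u y t))"
proof -
  have cu: "continuous_on (({0..1::real} \<times> T) \<times> {0..1}) (\<lambda>z. u (snd z) (snd (fst z)))"
    by (rule continuous_on_compose2[OF u[unfolded split_beta],
          where f = "\<lambda>z. (snd z, snd (fst z))", simplified]) (auto intro!: continuous_intros)
  have cs: "continuous_on (({0..1::real} \<times> T) \<times> {0..1::real}) (\<lambda>z. \<sigma> (snd (fst z)))"
    by (rule continuous_on_compose2[OF \<sigma>]) (auto intro!: continuous_intros)
  have "continuous_on ({0..1} \<times> T) (\<lambda>p. integral {fst p..1} (\<lambda>y. k (\<sigma> (snd p)) (fst p) y * u y (snd p)))"
    by (rule continuous_on_tail_integral)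
      (auto simp: split_beta intro!: continuous_on_mult k cu cs continuous_intros)
  then show ?thesis by (simp add: split_beta)
qed

lemma continuous_on_snd_arg:
  "continuous_on T (f :: real \<Rightarrow> real) \<Longrightarrow> continuous_on ({0..1::real} \<times> T) (\<lambda>z. f (snd z))"
  by (rule continuous_on_compose2) (auto intro!: continuous_intros)

lemma backstep_joint_continuous:
  fixes v v1 v2 :: "real \<Rightarrow> real \<Rightarrow> real" and \<sigma> :: "real \<Rightarrow> real"
  assumes \<sigma>: "continuous_on T \<sigma>"
    and v: "continuous_on ({0..1} \<times> T) (\<lambda>(x, t). v x t)"
  shows "continuous_on ({0..1} \<times> T) (\<lambda>(x, t). backstep (\<sigma> t) (\<lambda>x. v x t) x)"
    "continuous_on ({0..1} \<times> T) (\<lambda>(x, t). v1 x t) \<Longrightarrow>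
     continuous_on ({0..1} \<times> T) (\<lambda>(x, t). backstep1 (\<sigma> t) (\<lambda>x. v x t) (\<lambda>x. v1 x t) x)"
    "continuous_on ({0..1} \<times> T) (\<lambda>(x, t). v1 x t) \<Longrightarrow> continuous_on ({0..1} \<times> T) (\<lambda>(x, t). v2 x t) \<Longrightarrow>
     continuous_on ({0..1} \<times> T) (\<lambda>(x, t). backstep2 (\<sigma> t) (\<lambda>x. v x t) (\<lambda>x. v1 x t) (\<lambda>x. v2 x t) x)"
proof -
  note k = backstep_kernel_continuous[OF v \<sigma>, unfolded split_beta]
  note c = continuous_on_snd_arg[OF \<sigma>] v[unfolded split_beta]
  have k0: "continuous_on ({0..1} \<times> T) (\<lambda>z. integral {fst z..1} (\<lambda>y. bs_kernel (\<sigma> (snd z)) (fst z) y * v y (snd z)))"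
    and k1: "continuous_on ({0..1} \<times> T) (\<lambda>z. integral {fst z..1} (\<lambda>y. bs_kernel_x (\<sigma> (snd z)) (fst z) y * v y (snd z)))"
    and k2: "continuous_on ({0..1} \<times> T) (\<lambda>z. integral {fst z..1} (\<lambda>y. bs_kernel_xx (\<sigma> (snd z)) (fst z) y * v y (snd z)))"
    by (rule k, rule bs_kernel_continuous; assumption)+
  show "continuous_on ({0..1} \<times> T) (\<lambda>(x, t). backstep (\<sigma> t) (\<lambda>x. v x t) x)"
    unfolding backstep_def split_beta by (intro continuous_on_diff k0 c)
  show "continuous_on ({0..1} \<times> T) (\<lambda>(x, t). backstep1 (\<sigma> t) (\<lambda>x. v x t) (\<lambda>x. v1 x t) x)"
    if "continuous_on ({0..1} \<times> T) (\<lambda>(x, t). v1 x t)"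
    unfolding backstep1_def split_beta by (intro continuous_intros k1 c that[unfolded split_beta]) simp
  show "continuous_on ({0..1} \<times> T) (\<lambda>(x, t). backstep2 (\<sigma> t) (\<lambda>x. v x t) (\<lambda>x. v1 x t) (\<lambda>x. v2 x t) x)"
    if "continuous_on ({0..1} \<times> T) (\<lambda>(x, t). v1 x t)" "continuous_on ({0..1} \<times> T) (\<lambda>(x, t). v2 x t)"
    unfolding backstep2_def split_beta by (intro continuous_intros k2 c that[unfolded split_beta]) simp_all
qed

lemma backstep_has_time_derivative:
  fixes \<sigma> \<sigma>' :: "real \<Rightarrow> real" and v G :: "real \<Rightarrow> real \<Rightarrow> real"
  assumes T: "open T" "convex T" "t \<in> T" and x: "x \<in> {0..1}"
    and d\<sigma>: "\<And>t. t \<in> T \<Longrightarrow> (\<sigma> has_real_derivative \<sigma>' t) (at t)"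
    and c\<sigma>': "continuous_on T \<sigma>'"
    and v: "continuous_on ({0..1} \<times> T) (\<lambda>(x, t). v x t)"
    and G: "continuous_on ({0..1} \<times> T) (\<lambda>(x, t). G x t)"
    and dv: "\<And>x t. x \<in> {0..1} \<Longrightarrow> t \<in> T \<Longrightarrow> ((\<lambda>t. v x t) has_real_derivative G x t) (at t)"
  shows "((\<lambda>t. backstep (\<sigma> t) (\<lambda>x. v x t) x) has_real_derivative
     (G x t - integral {x..1} (\<lambda>y. \<sigma>' t * bs_kernel_s (\<sigma> t) x y * v y t + bs_kernel (\<sigma> t) x y * G y t))) (at t)"
proof -
  have c\<sigma>: "continuous_on T \<sigma>"
    by (rule DERIV_continuous_on, rule has_field_derivative_at_within, rule d\<sigma>)
  have sw: "continuous_on (T \<times> {x..1}) (\<lambda>z. H (snd z) (fst z))"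
    if "continuous_on ({0..1} \<times> T) (\<lambda>(x, t). H x t)" for H :: "real \<Rightarrow> real \<Rightarrow> real"
    by (rule continuous_on_compose2[OF that[unfolded split_beta],
        where f = "\<lambda>z. (snd z, fst z)", simplified]) (use x in \<open>auto intro!: continuous_intros\<close>)
  have fs: "continuous_on (T \<times> {x..1}) (\<lambda>z. f (fst z))" if "continuous_on T f" for f :: "real \<Rightarrow> real"
    by (rule continuous_on_compose2[OF that]) (auto intro!: continuous_intros)
  have "((\<lambda>t. integral (cbox x 1) (\<lambda>y. bs_kernel (\<sigma> t) x y * v y t)) has_real_derivative
     integral (cbox x 1) (\<lambda>y. \<sigma>' t * bs_kernel_s (\<sigma> t) x y * v y t + bs_kernel (\<sigma> t) x y * G y t)) (at t within T)"
  proof (rule leibniz_rule_field_derivative[OF _ _ _ T(3,2)])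
    fix t y assume t: "t \<in> T" and y: "y \<in> cbox x 1"
    have "((\<lambda>t. bs_kernel (\<sigma> t) x y * v y t) has_real_derivative
        \<sigma>' t * bs_kernel_s (\<sigma> t) x y * v y t + bs_kernel (\<sigma> t) x y * G y t) (at t)"
      using DERIV_mult[OF DERIV_chain2[OF bs_kernel_derivs(5) d\<sigma>[OF t]] dv[OF _ t, of y]] x y
      by (simp add: algebra_simps)
    then show "((\<lambda>t. bs_kernel (\<sigma> t) x y * v y t) has_real_derivative
        \<sigma>' t * bs_kernel_s (\<sigma> t) x y * v y t + bs_kernel (\<sigma> t) x y * G y t) (at t within T)"
      by (rule has_field_derivative_at_within)
  next
    fix t assume t: "t \<in> T"
    have "continuous_on {x..1} (\<lambda>y. v y t)"
      by (rule continuous_on_subset[OF continuous_on_section(2)[OF v t]]) (use x in auto)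
    then show "(\<lambda>y. bs_kernel (\<sigma> t) x y * v y t) integrable_on cbox x 1"
      by (auto intro!: integrable_continuous_real continuous_intros)
  next
    show "continuous_on (T \<times> cbox x 1)
        (\<lambda>(t, y). \<sigma>' t * bs_kernel_s (\<sigma> t) x y * v y t + bs_kernel (\<sigma> t) x y * G y t)"
      unfolding split_beta cbox_interval
      by (intro continuous_on_add continuous_on_mult bs_kernel_continuous fs c\<sigma> c\<sigma>' sw[OF v] sw[OF G]
         continuous_on_const continuous_on_snd continuous_on_id)
  qed
  then have "((\<lambda>t. integral {x..1} (\<lambda>y. bs_kernel (\<sigma> t) x y * v y t)) has_real_derivative
     integral {x..1} (\<lambda>y. \<sigma>' t * bs_kernel_s (\<sigma> t) x y * v y t + bs_kernel (\<sigma> t) x y * G y t)) (at t)"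
    by (simp add: at_within_open[OF T(3,1)])
  from DERIV_diff[OF dv[OF x T(3)] this] show ?thesis
    unfolding backstep_def .
qed

section \<open>Energy decay of the target system\<close>

text \<open>
  Here \<open>w(\<xi>, t)\<close> is a solution of the damped heat equation on \<open>{0..s t}\<close>, pulled back to the unit
  interval, and \<open>E\<close> is its squared \<open>H\<^sup>1\<close> norm. The diffusion contributes
  \<open>- 2 \<alpha> (\<integral> w\<^sub>x\<^sup>2 + \<integral> w\<^sub>x\<^sub>x\<^sup>2)\<close>, the damping \<open>- 2 \<lambda> E\<close>. The derivatives of the weights \<open>s\<close> and
  \<open>1 / s\<close> cancel against the transport term up to \<open>- s' w\<^sub>x(1)\<^sup>2 / s\<^sup>2\<close>, which is where an advancing interface
  is essential. Regularity at \<open>t = 0\<close> is only continuity, so monotonicity of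
  \<open>exp (2 \<lambda> t) E t\<close> is derived from its derivative on the open half-line.
\<close>

lemma target_energy_decay:
  fixes w w1 w2 wt :: "real \<Rightarrow> real \<Rightarrow> real" and s s' :: "real \<Rightarrow> real" and \<alpha> lam :: real
  assumes \<alpha>: "\<alpha> > 0" and s_pos: "\<And>t. t \<ge> 0 \<Longrightarrow> s t > 0"
    and cs: "continuous_on {0..} s"
    and ds: "\<And>t. t > 0 \<Longrightarrow> (s has_real_derivative s' t) (at t)"
    and s'_nonneg: "\<And>t. t > 0 \<Longrightarrow> s' t \<ge> 0"
    and cw: "continuous_on ({0..1} \<times> {0..}) (\<lambda>(x, t). w x t)"
    and cw1: "continuous_on ({0..1} \<times> {0..}) (\<lambda>(x, t). w1 x t)"
    and cw2: "continuous_on ({0..1} \<times> {0<..}) (\<lambda>(x, t). w2 x t)"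
    and cwt: "continuous_on ({0..1} \<times> {0<..}) (\<lambda>(x, t). wt x t)"
    and dw: "\<And>x t. x \<in> {0..1} \<Longrightarrow> t > 0 \<Longrightarrow>
      ((\<lambda>x. w x t) has_real_derivative w1 x t) (at x within {0..1})"
    and dw1: "\<And>x t. x \<in> {0..1} \<Longrightarrow> t > 0 \<Longrightarrow>
      ((\<lambda>x. w1 x t) has_real_derivative w2 x t) (at x within {0..1})"
    and dwt: "\<And>x t. x \<in> {0..1} \<Longrightarrow> t > 0 \<Longrightarrow> ((\<lambda>t. w x t) has_real_derivative wt x t) (at t)"
    and bc: "\<And>t. t > 0 \<Longrightarrow> w 1 t = 0" "\<And>t. t > 0 \<Longrightarrow> w1 0 t = 0"
    and pde: "\<And>x t. x \<in> {0..1} \<Longrightarrow> t > 0 \<Longrightarrow>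
      wt x t = \<alpha> / (s t)\<^sup>2 * w2 x t + x * (s' t / s t) * w1 x t - lam * w x t"
  defines "E \<equiv> \<lambda>t. s t * integral {0..1} (\<lambda>x. (w x t)\<^sup>2) + integral {0..1} (\<lambda>x. (w1 x t)\<^sup>2) / s t"
  assumes t: "t \<ge> 0"
  shows "E t \<le> exp (- 2 * lam * t) * E 0"
proof -
  have cE: "continuous_on {0..} E"
  proof -
    have *: "continuous_on {0..} (\<lambda>t. integral {0..1} (\<lambda>x. (H x t)\<^sup>2))"
      if "continuous_on ({0..1} \<times> {0..}) (\<lambda>(x, t). H x t)" for H :: "real \<Rightarrow> real \<Rightarrow> real"
    proof -
      have "continuous_on ({0..} \<times> {0..1}) (\<lambda>z. H (snd z) (fst z))"
        by (rule continuous_on_compose2[OF that[unfolded split_beta],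
            where f = "\<lambda>z. (snd z, fst z)", simplified]) (auto intro!: continuous_intros)
      then have "continuous_on ({0..} \<times> cbox 0 1) (\<lambda>(t, x). (H x t)\<^sup>2)"
        unfolding split_beta cbox_interval by (rule continuous_on_power)
      from integral_continuous_on_param[OF this] show ?thesis by simp
    qed
    show ?thesis
      unfolding E_def using s_pos
      by (intro continuous_intros *[OF cw] *[OF cw1] cs) (auto simp: less_le)
  qed
  have dE: "\<exists>D. (E has_real_derivative D) (at \<tau>) \<and> D \<le> - 2 * lam * E \<tau>" if \<tau>: "\<tau> > 0" for \<tau>
  proof -
    let ?I = "integral {0..1}"
    let ?b = "s' \<tau> / s \<tau>" and ?a = "\<alpha> / (s \<tau>)\<^sup>2"
    have st: "s \<tau> > 0" using s_pos \<tau> by simp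
    have T: "open {0::real<..}" "convex {0::real<..}" "\<tau> \<in> {0<..}" using \<tau> by auto
    define A where "A = ?I (\<lambda>x. (w x \<tau>)\<^sup>2)"
    define B where "B = ?I (\<lambda>x. (w1 x \<tau>)\<^sup>2)"
    define C where "C = ?I (\<lambda>x. (w2 x \<tau>)\<^sup>2)"
    have c: "continuous_on {0..1} (\<lambda>x. w x \<tau>)" "continuous_on {0..1} (\<lambda>x. w1 x \<tau>)"
      "continuous_on {0..1} (\<lambda>x. w2 x \<tau>)" "continuous_on {0..1} (\<lambda>x. wt x \<tau>)"
      by (rule continuous_on_section(2)[OF cw], use \<tau> in simp,
          rule continuous_on_section(2)[OF cw1], use \<tau> in simp,
          rule continuous_on_section(2)[OF cw2], use \<tau> in simp,
          rule continuous_on_section(2)[OF cwt], use \<tau> in simp)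
    note ci = integrable_continuous_real continuous_intros c
    note d = dw[OF _ \<tau>] dw1[OF _ \<tau>]
    have "((\<lambda>t. ?I (\<lambda>x. (w1 x t)\<^sup>2)) has_real_derivative - 2 * ?I (\<lambda>x. wt x \<tau> * w2 x \<tau>)) (at \<tau>)"
      by (rule dirichlet_energy_has_derivative[OF T, where w = w]) (use dw dw1 dwt cw2 cwt bc in auto)
    moreover have "((\<lambda>t. ?I (\<lambda>x. (w x t)\<^sup>2)) has_real_derivative ?I (\<lambda>x. 2 * w x \<tau> * wt x \<tau>)) (at \<tau>)"
    proof -
      have sw: "continuous_on ({0<..} \<times> {0..1}) (\<lambda>z. H (snd z) (fst z))"
        if "continuous_on ({0..1} \<times> {0<..}) (\<lambda>(x, t). H x t)" for H :: "real \<Rightarrow> real \<Rightarrow> real"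
        by (rule continuous_on_compose2[OF that[unfolded split_beta],
            where f = "\<lambda>z. (snd z, fst z)", simplified]) (auto intro!: continuous_intros)
      have cw': "continuous_on ({0..1} \<times> {0<..}) (\<lambda>(x, t). w x t)"
        by (rule continuous_on_subset[OF cw]) auto
      have "((\<lambda>t. integral (cbox 0 1) (\<lambda>x. (w x t)\<^sup>2)) has_real_derivative
          integral (cbox 0 1) (\<lambda>x. 2 * w x \<tau> * wt x \<tau>)) (at \<tau> within {0<..})"
      proof (rule leibniz_rule_field_derivative[OF _ _ _ T(3,2)])
        fix t x :: real assume "t \<in> {0<..}" "x \<in> cbox 0 1"
        then have "((\<lambda>t. w x t) has_real_derivative wt x t) (at t within {0<..})"
          by (auto intro!: has_field_derivative_at_within[OF dwt])
        from DERIV_power[OF this, of 2]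
        show "((\<lambda>t. (w x t)\<^sup>2) has_real_derivative 2 * w x t * wt x t) (at t within {0<..})"
          by (simp add: algebra_simps)
      next
        fix t :: real assume "t \<in> {0<..}"
        from continuous_on_section(2)[OF cw' this]
        show "(\<lambda>x. (w x t)\<^sup>2) integrable_on cbox 0 1"
          by (auto intro!: integrable_continuous_real continuous_intros)
      next
        show "continuous_on ({0<..} \<times> cbox 0 1) (\<lambda>(t, x). 2 * w x t * wt x t)"
          unfolding split_beta cbox_interval
          by (intro continuous_on_mult continuous_on_const sw[OF cw'] sw[OF cwt])
      qed
      then show ?thesis by (simp add: at_within_open[OF T(3,1)])
    qed
    ultimately have dE: "(E has_real_derivative
        s' \<tau> * A + s \<tau> * ?I (\<lambda>x. 2 * w x \<tau> * wt x \<tau>)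
        + ((- 2 * ?I (\<lambda>x. wt x \<tau> * w2 x \<tau>)) * s \<tau> - B * s' \<tau>) / (s \<tau> * s \<tau>)) (at \<tau>)"
      unfolding E_def A_def B_def using st
      by (intro DERIV_add DERIV_divide) (auto intro!: derivative_eq_intros ds[OF \<tau>])
    have j1: "?I (\<lambda>x. w x \<tau> * w2 x \<tau>) = - B"
    proof -
      have "?I (\<lambda>x. w x \<tau> * w2 x \<tau>) = w 1 \<tau> * w1 1 \<tau> - w 0 \<tau> * w1 0 \<tau> - ?I (\<lambda>x. w1 x \<tau> * w1 x \<tau>)"
        by (rule integral_by_parts_real[OF _ d]) (auto intro: c)
      then show ?thesis using bc[OF \<tau>] by (simp add: B_def power2_eq_square)
    qed
    have j2: "?I (\<lambda>x. x * (w x \<tau> * w1 x \<tau>)) = - A / 2"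
    proof -
      have "?I (\<lambda>x. x * (2 * w x \<tau> * w1 x \<tau>)) = 1 * (w 1 \<tau>)\<^sup>2 - 0 * (w 0 \<tau>)\<^sup>2 - ?I (\<lambda>x. 1 * (w x \<tau>)\<^sup>2)"
        using DERIV_power[OF d(1), of _ 2]
        by (intro integral_by_parts_real) (auto intro!: ci derivative_eq_intros d(1) simp: algebra_simps)
      moreover have "?I (\<lambda>x. x * (2 * w x \<tau> * w1 x \<tau>)) = 2 * ?I (\<lambda>x. x * (w x \<tau> * w1 x \<tau>))"
        by (subst integral_mult_right[symmetric]) (simp add: algebra_simps)
      ultimately show ?thesis using bc(1)[OF \<tau>] by (simp add: A_def)
    qed
    have j3: "?I (\<lambda>x. x * (w1 x \<tau> * w2 x \<tau>)) = (w1 1 \<tau>)\<^sup>2 / 2 - B / 2"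
    proof -
      have "?I (\<lambda>x. x * (2 * w1 x \<tau> * w2 x \<tau>)) = 1 * (w1 1 \<tau>)\<^sup>2 - 0 * (w1 0 \<tau>)\<^sup>2 - ?I (\<lambda>x. 1 * (w1 x \<tau>)\<^sup>2)"
        by (intro integral_by_parts_real) (auto intro!: ci derivative_eq_intros d(2) simp: algebra_simps)
      moreover have "?I (\<lambda>x. x * (2 * w1 x \<tau> * w2 x \<tau>)) = 2 * ?I (\<lambda>x. x * (w1 x \<tau> * w2 x \<tau>))"
        by (subst integral_mult_right[symmetric]) (simp add: algebra_simps)
      ultimately show ?thesis by (simp add: B_def)
    qed
    have k1: "?I (\<lambda>x. 2 * w x \<tau> * wt x \<tau>) = 2 * (- ?a * B - ?b * A / 2 - lam * A)"
    proof -
      have "?I (\<lambda>x. 2 * w x \<tau> * wt x \<tau>) = ?I (\<lambda>x. 2 * ?a * (w x \<tau> * w2 x \<tau>)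
          + 2 * ?b * (x * (w x \<tau> * w1 x \<tau>)) + (- 2 * lam) * (w x \<tau>)\<^sup>2)"
        by (rule integral_cong) (simp add: pde \<tau> algebra_simps power2_eq_square)
      also have "\<dots> = 2 * ?a * (- B) + 2 * ?b * (- A / 2) + (- 2 * lam) * A"
        unfolding j1[symmetric] j2[symmetric] unfolding A_def by (rule integral_linear_combination3; intro ci)
      finally show ?thesis by (simp add: algebra_simps)
    qed
    have k2: "?I (\<lambda>x. wt x \<tau> * w2 x \<tau>) = ?a * C + ?b * ((w1 1 \<tau>)\<^sup>2 / 2 - B / 2) + lam * B"
    proof -
      have "?I (\<lambda>x. wt x \<tau> * w2 x \<tau>) = ?I (\<lambda>x. ?a * (w2 x \<tau>)\<^sup>2
          + ?b * (x * (w1 x \<tau> * w2 x \<tau>)) + (- lam) * (w x \<tau> * w2 x \<tau>))"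
        by (rule integral_cong) (simp add: pde \<tau> algebra_simps power2_eq_square)
      also have "\<dots> = ?a * C + ?b * ((w1 1 \<tau>)\<^sup>2 / 2 - B / 2) + (- lam) * (- B)"
        unfolding j1[symmetric] j3[symmetric] C_def by (rule integral_linear_combination3; intro ci)
      finally show ?thesis by simp
    qed
    have BC: "B \<ge> 0" "C \<ge> 0" unfolding B_def C_def by (auto intro!: integral_nonneg ci)
    have "s' \<tau> * A + s \<tau> * ?I (\<lambda>x. 2 * w x \<tau> * wt x \<tau>)
        + ((- 2 * ?I (\<lambda>x. wt x \<tau> * w2 x \<tau>)) * s \<tau> - B * s' \<tau>) / (s \<tau> * s \<tau>)
      = - 2 * lam * (s \<tau> * A + B / s \<tau>) - 2 * \<alpha> * B / s \<tau> - 2 * \<alpha> * C / (s \<tau>) ^ 3 - s' \<tau> * (w1 1 \<tau>)\<^sup>2 / (s \<tau>)\<^sup>2"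
      unfolding k1 k2 using st
      by (simp add: field_simps power2_eq_square power3_eq_cube)
    also have "\<dots> \<le> - 2 * lam * (s \<tau> * A + B / s \<tau>)"
    proof -
      have "0 \<le> 2 * \<alpha> * B / s \<tau>" "0 \<le> 2 * \<alpha> * C / (s \<tau>) ^ 3" "0 \<le> s' \<tau> * (w1 1 \<tau>)\<^sup>2 / (s \<tau>)\<^sup>2"
        using BC st \<alpha> s'_nonneg[OF \<tau>] by simp_all
      then show ?thesis by linarith
    qed
    also have "s \<tau> * A + B / s \<tau> = E \<tau>" by (simp add: E_def A_def B_def)
    finally show ?thesis using dE by blast
  qed
  have "exp (2 * lam * t) * E t \<le> exp (2 * lam * 0) * E 0"
  proof (rule DERIV_nonpos_imp_decreasing_open[OF t])
    fix \<tau> assume "0 < \<tau>" "\<tau> < t"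
    then obtain D where D: "(E has_real_derivative D) (at \<tau>)" "D \<le> - 2 * lam * E \<tau>" using dE by blast
    have "((\<lambda>t. exp (2 * lam * t) * E t) has_real_derivative exp (2 * lam * \<tau>) * (2 * lam * E \<tau> + D)) (at \<tau>)"
      by (auto intro!: derivative_eq_intros D(1) simp: algebra_simps)
    moreover have "exp (2 * lam * \<tau>) * (2 * lam * E \<tau> + D) \<le> 0"
      using D(2) by (intro mult_nonneg_nonpos) auto
    ultimately show "\<exists>y. ((\<lambda>t. exp (2 * lam * t) * E t) has_real_derivative y) (at \<tau>) \<and> y \<le> 0" by blast
  next
    show "continuous_on {0..t} (\<lambda>t. exp (2 * lam * t) * E t)"
      by (intro continuous_intros continuous_on_subset[OF cE]) auto
  qed
  then have "exp (- (2 * lam * t)) * (exp (2 * lam * t) * E t) \<le> exp (- (2 * lam * t)) * E 0"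
    by (intro mult_left_mono) auto
  then show ?thesis by (simp add: mult.assoc[symmetric] flip: exp_add)
qed

section \<open>Norm equivalence under the transformation\<close>

text \<open>
  The Cauchy-Schwarz inequality on an interval of length at most 1, obtained by expanding
  \<open>\<integral> (k v - I)\<^sup>2 \<ge> 0\<close> with \<open>I = \<integral> k v\<close>.
\<close>

lemma tail_integral_square_le:
  fixes k v :: "real \<Rightarrow> real"
  assumes x: "x \<in> {0..1}" and c: "continuous_on {x..1} k" "continuous_on {x..1} v"
    and k: "\<And>y. y \<in> {x..1} \<Longrightarrow> \<bar>k y\<bar> \<le> A"
  shows "(integral {x..1} (\<lambda>y. k y * v y))\<^sup>2 \<le> A\<^sup>2 * integral {x..1} (\<lambda>y. (v y)\<^sup>2)"
proof -
  define I where "I = integral {x..1} (\<lambda>y. k y * v y)"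
  have "0 \<le> integral {x..1} (\<lambda>y. (k y * v y - I)\<^sup>2)"
    by (intro integral_nonneg integrable_continuous_real continuous_intros c) auto
  also have "\<dots> = integral {x..1} (\<lambda>y. 1 * (k y * v y)\<^sup>2 + (- 2 * I) * (k y * v y) + I\<^sup>2 * 1)"
    by (simp add: power2_eq_square algebra_simps)
  also have "\<dots> = 1 * integral {x..1} (\<lambda>y. (k y * v y)\<^sup>2) + (- 2 * I) * I + I\<^sup>2 * integral {x..1} (\<lambda>_. 1)"
    unfolding I_def by (rule integral_linear_combination3; intro continuous_intros c)
  also have "\<dots> = integral {x..1} (\<lambda>y. (k y * v y)\<^sup>2) - I\<^sup>2 - x * I\<^sup>2"
    using x by (simp add: algebra_simps power2_eq_square)
  finally have "I\<^sup>2 \<le> integral {x..1} (\<lambda>y. (k y * v y)\<^sup>2) - x * I\<^sup>2" by simp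
  also have "\<dots> \<le> integral {x..1} (\<lambda>y. (k y * v y)\<^sup>2)" using x by simp
  also have "\<dots> \<le> integral {x..1} (\<lambda>y. A\<^sup>2 * (v y)\<^sup>2)"
  proof (intro integral_le integrable_continuous_real continuous_intros c)
    fix y assume "y \<in> {x..1}"
    then have "\<bar>k y\<bar>\<^sup>2 \<le> A\<^sup>2" using k by (intro power_mono) auto
    then show "(k y * v y)\<^sup>2 \<le> A\<^sup>2 * (v y)\<^sup>2"
      by (simp add: power_mult_distrib mult_right_mono)
  qed
  finally show ?thesis by (simp add: I_def)
qed

text \<open>
  A Gronwall argument that bounds the inverse of a Volterra transformation without constructing
  its kernel. In the norm with weight \<open>exp (\<mu> x)\<close> a tail integral gains a factor \<open>1 / \<mu>\<close>, so for
  large \<open>\<mu>\<close> the Volterra term is absorbed by the left-hand side.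
\<close>

lemma volterra_inverse_bound:
  fixes v w :: "real \<Rightarrow> real"
  assumes c: "continuous_on {0..1} v" "continuous_on {0..1} w" and B: "B \<ge> 0"
    and vw: "\<And>x. x \<in> {0..1} \<Longrightarrow> (v x)\<^sup>2 \<le> 2 * (w x)\<^sup>2 + B * integral {x..1} (\<lambda>y. (v y)\<^sup>2)"
  shows "integral {0..1} (\<lambda>x. (v x)\<^sup>2) \<le> 4 * exp (2 * B + 1) * integral {0..1} (\<lambda>x. (w x)\<^sup>2)"
proof -
  \<comment> \<open>With this weight \<open>B / \<mu> \<le> 1 / 2\<close>, so the Volterra term is at most half of \<open>P\<close>.\<close>
  define \<mu> where "\<mu> = 2 * B + 1"
  have \<mu>: "\<mu> > 0" using B by (simp add: \<mu>_def)
  define \<Phi> where "\<Phi> x = integral {x..1} (\<lambda>y. (v y)\<^sup>2)" for x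
  have d\<Phi>: "(\<Phi> has_real_derivative - (v x)\<^sup>2) (at x within {0..1})" if "x \<in> {0..1}" for x
    unfolding \<Phi>_def by (rule integral_has_real_derivative'[OF _ that]) (intro continuous_intros c)
  have c\<Phi>: "continuous_on {0..1} \<Phi>" by (rule DERIV_continuous_on[OF d\<Phi>])
  note ci = integrable_continuous_real continuous_intros c c\<Phi>
  define P where "P = integral {0..1} (\<lambda>x. exp (\<mu> * x) * (v x)\<^sup>2)"
  define Q where "Q = integral {0..1} (\<lambda>x. exp (\<mu> * x) * (w x)\<^sup>2)"
  have "integral {0..1} (\<lambda>x. \<Phi> x * (\<mu> * exp (\<mu> * x)))
    = \<Phi> 1 * exp (\<mu> * 1) - \<Phi> 0 * exp (\<mu> * 0) - integral {0..1} (\<lambda>x. - (v x)\<^sup>2 * exp (\<mu> * x))"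
    by (rule integral_by_parts_real[OF _ d\<Phi>]) (auto intro!: derivative_eq_intros ci)
  moreover have "integral {0..1} (\<lambda>x. \<Phi> x * (\<mu> * exp (\<mu> * x))) = \<mu> * integral {0..1} (\<lambda>x. exp (\<mu> * x) * \<Phi> x)"
    by (subst integral_mult_right[symmetric]) (simp add: algebra_simps)
  moreover have "integral {0..1} (\<lambda>x. - (v x)\<^sup>2 * exp (\<mu> * x)) = - P"
    unfolding P_def by (subst integral_neg[symmetric]) (simp add: algebra_simps)
  moreover have "\<Phi> 1 = 0" by (simp add: \<Phi>_def)
  moreover have "\<Phi> 0 \<ge> 0" unfolding \<Phi>_def by (intro integral_nonneg ci) auto
  ultimately have "\<mu> * integral {0..1} (\<lambda>x. exp (\<mu> * x) * \<Phi> x) \<le> P" by simp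
  then have "2 * B * integral {0..1} (\<lambda>x. exp (\<mu> * x) * \<Phi> x) + integral {0..1} (\<lambda>x. exp (\<mu> * x) * \<Phi> x) \<le> P"
    by (simp add: \<mu>_def algebra_simps)
  moreover have "0 \<le> integral {0..1} (\<lambda>x. exp (\<mu> * x) * \<Phi> x)"
    by (intro integral_nonneg ci)
      (auto simp: \<Phi>_def intro!: mult_nonneg_nonneg integral_nonneg integrable_continuous_real
        continuous_intros continuous_on_subset[OF c(1)])
  ultimately have weight: "B * integral {0..1} (\<lambda>x. exp (\<mu> * x) * \<Phi> x) \<le> P / 2" by linarith
  have "P \<le> integral {0..1} (\<lambda>x. 2 * (exp (\<mu> * x) * (w x)\<^sup>2) + B * (exp (\<mu> * x) * \<Phi> x) + 0 * 0)"
    unfolding P_def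
  proof (intro integral_le ci)
    fix x :: real assume "x \<in> {0..1}"
    from mult_left_mono[OF vw[OF this], of "exp (\<mu> * x)"]
    show "exp (\<mu> * x) * (v x)\<^sup>2 \<le> 2 * (exp (\<mu> * x) * (w x)\<^sup>2) + B * (exp (\<mu> * x) * \<Phi> x) + 0 * 0"
      by (simp add: \<Phi>_def algebra_simps)
  qed
  also have "\<dots> = 2 * Q + B * integral {0..1} (\<lambda>x. exp (\<mu> * x) * \<Phi> x) + 0 * integral {0..1} (\<lambda>x::real. 0)"
    unfolding Q_def by (rule integral_linear_combination3; intro ci)
  finally have "P \<le> 4 * Q" using weight by simp
  moreover have "integral {0..1} (\<lambda>x. (v x)\<^sup>2) \<le> P"
    unfolding P_def
  proof (intro integral_le ci)
    fix x :: real assume "x \<in> {0..1}"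
    then have "1 \<le> exp (\<mu> * x)" using \<mu> by simp
    then show "(v x)\<^sup>2 \<le> exp (\<mu> * x) * (v x)\<^sup>2" using mult_right_mono[of 1 "exp (\<mu> * x)" "(v x)\<^sup>2"] by simp
  qed
  moreover have "Q \<le> integral {0..1} (\<lambda>x. exp \<mu> * (w x)\<^sup>2)"
    unfolding Q_def
  proof (intro integral_le ci)
    fix x :: real assume "x \<in> {0..1}"
    then have "\<mu> * x \<le> \<mu> * 1" using \<mu> by (intro mult_left_mono) auto
    then show "exp (\<mu> * x) * (w x)\<^sup>2 \<le> exp \<mu> * (w x)\<^sup>2" by (simp add: mult_right_mono)
  qed
  ultimately show ?thesis by (simp add: \<mu>_def)
qed

lemma bs_kernel_bounds:
  assumes "R \<ge> 0"
  obtains A where "A > 0"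
    "\<And>\<sigma> x y. \<sigma> \<in> {0..R} \<Longrightarrow> x \<in> {0..1} \<Longrightarrow> y \<in> {0..1} \<Longrightarrow> \<bar>bs_kernel \<sigma> x y\<bar> \<le> A * \<sigma>"
    "\<And>\<sigma> x y. \<sigma> \<in> {0..R} \<Longrightarrow> x \<in> {0..1} \<Longrightarrow> y \<in> {0..1} \<Longrightarrow> \<bar>bs_kernel_x \<sigma> x y\<bar> \<le> A * \<sigma>"
proof -
  have bd: "\<exists>B\<ge>0. \<forall>p\<in>{-R..R}. \<bar>f p\<bar> \<le> B" if "continuous_on {-R..R} f" for f :: "real \<Rightarrow> real"
  proof -
    have "bounded (f ` {-R..R})"
      by (intro compact_imp_bounded compact_continuous_image that) auto
    then obtain B where "\<forall>y\<in>f ` {-R..R}. norm y \<le> B" by (auto simp: bounded_iff)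
    then show ?thesis by (intro exI[of _ "max B 0"]) (auto intro: max.coboundedI1)
  qed
  have "continuous_on {-R..R} bessel_ser" "continuous_on {-R..R} bessel_ser1"
    by (intro continuous_on_bessel_ser continuous_on_id)+
  then obtain B0 B1 where B: "B0 \<ge> 0" "B1 \<ge> 0" "\<And>p. p \<in> {-R..R} \<Longrightarrow> \<bar>bessel_ser p\<bar> \<le> B0"
    "\<And>p. p \<in> {-R..R} \<Longrightarrow> \<bar>bessel_ser1 p\<bar> \<le> B1"
    using bd by metis
  show thesis
  proof (rule that[of "B0 + 2 * R * B1 + 1"])
    show "B0 + 2 * R * B1 + 1 > 0" using B assms by (simp add: add_nonneg_pos)
  next
    fix \<sigma> x y :: real assume *: "\<sigma> \<in> {0..R}" "x \<in> {0..1}" "y \<in> {0..1}"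
    have "x\<^sup>2 \<le> 1" "y\<^sup>2 \<le> 1" using * by (simp_all add: power_le_one)
    then have "\<bar>x\<^sup>2 - y\<^sup>2\<bar> \<le> 1" using zero_le_power2[of x] zero_le_power2[of y] by linarith
    then have "\<bar>\<sigma> * (x\<^sup>2 - y\<^sup>2)\<bar> \<le> R * 1" unfolding abs_mult using * by (intro mult_mono) auto
    then have p: "\<sigma> * (x\<^sup>2 - y\<^sup>2) \<in> {-R..R}" by auto
    have "\<bar>bs_kernel \<sigma> x y\<bar> = \<sigma> * y * \<bar>bessel_ser (\<sigma> * (x\<^sup>2 - y\<^sup>2))\<bar>"
      using * by (simp add: bs_kernel_def abs_mult)
    also have "\<dots> \<le> \<sigma> * 1 * B0" using * B(3)[OF p] B(1) by (intro mult_mono) auto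
    also have "\<dots> \<le> (B0 + 2 * R * B1 + 1) * \<sigma>" using * B assms by (simp add: algebra_simps)
    finally show "\<bar>bs_kernel \<sigma> x y\<bar> \<le> (B0 + 2 * R * B1 + 1) * \<sigma>" .
    have "\<bar>bs_kernel_x \<sigma> x y\<bar> = 2 * (\<sigma> * \<sigma>) * (x * y) * \<bar>bessel_ser1 (\<sigma> * (x\<^sup>2 - y\<^sup>2))\<bar>"
      using * by (simp add: bs_kernel_x_def abs_mult power2_eq_square)
    also have "\<dots> \<le> 2 * (R * \<sigma>) * (1 * 1) * B1"
      using * B(4)[OF p] B(2) assms by (intro mult_mono) auto
    also have "\<dots> \<le> (B0 + 2 * R * B1 + 1) * \<sigma>" using * B assms by (simp add: algebra_simps)
    finally show "\<bar>bs_kernel_x \<sigma> x y\<bar> \<le> (B0 + 2 * R * B1 + 1) * \<sigma>" .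
  qed
qed

lemma square_add_le2: "(a + b)\<^sup>2 \<le> 2 * a\<^sup>2 + 2 * (b :: real)\<^sup>2"
  using zero_le_power2[of "a - b"] by (simp add: power2_eq_square algebra_simps)

lemma square_add_le3: "(a + b + d)\<^sup>2 \<le> 3 * a\<^sup>2 + 3 * b\<^sup>2 + 3 * (d :: real)\<^sup>2"
  using zero_le_power2[of "a - b"] zero_le_power2[of "b - d"] zero_le_power2[of "a - d"]
  by (simp add: power2_eq_square algebra_simps)

text \<open>
  The squared \<open>H\<^sup>1\<close> norm of \<open>u\<close> on \<open>{0..s}\<close> in terms of \<open>v(\<xi>) = u(\<xi> s)\<close> and \<open>v1 = v'\<close>; see
  \<open>H1_norm_sq_rescale\<close>.
\<close>

definition scaled_energy :: "real \<Rightarrow> (real \<Rightarrow> real) \<Rightarrow> (real \<Rightarrow> real) \<Rightarrow> real" where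
  "scaled_energy s v v1 = s * integral {0..1} (\<lambda>x. (v x)\<^sup>2) + integral {0..1} (\<lambda>x. (v1 x)\<^sup>2) / s"

text \<open>
  The constants must be uniform down to \<open>s = 0\<close>, because the initial interface position may be
  arbitrarily small. The kernel terms in the derivative of
  the transform are bounded by \<open>\<sigma>\<close> times norms of \<open>v\<close>, and the singular
  weight \<open>1 / s\<close> of the derivative part is harmless since \<open>\<sigma>\<^sup>2 / s = c\<^sup>2 s\<^sup>3\<close>.
\<close>

lemma backstep_energy_equivalence:
  assumes c: "c > 0" and sr: "sr > 0"
  obtains M1 M2 where "M1 > 0" "M2 > 0"
    "\<And>s (v :: real \<Rightarrow> real) v1. \<lbrakk>0 < s; s \<le> sr; continuous_on {0..1} v; continuous_on {0..1} v1\<rbrakk> \<Longrightarrow>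
       scaled_energy s (backstep (c * s\<^sup>2) v) (backstep1 (c * s\<^sup>2) v v1) \<le> M1 * scaled_energy s v v1"
    "\<And>s (v :: real \<Rightarrow> real) v1. \<lbrakk>0 < s; s \<le> sr; continuous_on {0..1} v; continuous_on {0..1} v1\<rbrakk> \<Longrightarrow>
       scaled_energy s v v1 \<le> M2 * scaled_energy s (backstep (c * s\<^sup>2) v) (backstep1 (c * s\<^sup>2) v v1)"
proof -
  define R where "R = c * sr\<^sup>2"
  have R: "R \<ge> 0" using c by (simp add: R_def)
  obtain A0 where A0: "A0 > 0"
    "\<And>\<sigma> x y. \<sigma> \<in> {0..R} \<Longrightarrow> x \<in> {0..1} \<Longrightarrow> y \<in> {0..1} \<Longrightarrow> \<bar>bs_kernel \<sigma> x y\<bar> \<le> A0 * \<sigma>"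
    "\<And>\<sigma> x y. \<sigma> \<in> {0..R} \<Longrightarrow> x \<in> {0..1} \<Longrightarrow> y \<in> {0..1} \<Longrightarrow> \<bar>bs_kernel_x \<sigma> x y\<bar> \<le> A0 * \<sigma>"
    using bs_kernel_bounds[OF R] by metis
  \<comment> \<open>The summand 1 makes \<open>A \<sigma>\<close> also dominate the diagonal value \<open>\<sigma> x / 2\<close>.\<close>
  define A where "A = A0 + 1"
  have A: "A \<ge> 1" using A0 by (simp add: A_def)
  have kb: "\<bar>bs_kernel \<sigma> x y\<bar> \<le> A * \<sigma>" "\<bar>bs_kernel_x \<sigma> x y\<bar> \<le> A * \<sigma>"
    if "\<sigma> \<in> {0..R}" "x \<in> {0..1}" "y \<in> {0..1}" for \<sigma> x y
    using A0(2,3)[OF that] that(1) by (auto simp: A_def algebra_simps)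
  define B where "B = 2 * (A * R)\<^sup>2"
  define D where "D = 6 * (A * c * sr)\<^sup>2"
  have B: "B \<ge> 0" and D: "D \<ge> 0" by (simp_all add: B_def D_def)
  have main: "integral {0..1} (\<lambda>x. (backstep \<sigma> v x)\<^sup>2) \<le> (2 + B) * integral {0..1} (\<lambda>x. (v x)\<^sup>2)"
      "integral {0..1} (\<lambda>x. (v x)\<^sup>2) \<le> 4 * exp (2 * B + 1) * integral {0..1} (\<lambda>x. (backstep \<sigma> v x)\<^sup>2)"
      "integral {0..1} (\<lambda>x. (backstep1 \<sigma> v v1 x)\<^sup>2) / s
         \<le> 3 * (integral {0..1} (\<lambda>x. (v1 x)\<^sup>2) / s) + D * (s * integral {0..1} (\<lambda>x. (v x)\<^sup>2))"
      "integral {0..1} (\<lambda>x. (v1 x)\<^sup>2) / s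
         \<le> 3 * (integral {0..1} (\<lambda>x. (backstep1 \<sigma> v v1 x)\<^sup>2) / s) + D * (s * integral {0..1} (\<lambda>x. (v x)\<^sup>2))"
    if s: "0 < s" "s \<le> sr" and cv: "continuous_on {0..1} v" and cv1: "continuous_on {0..1} v1"
      and \<sigma>_def: "\<sigma> = c * s\<^sup>2" for s \<sigma> v v1
  proof -
    let ?V = "integral {0..1} (\<lambda>x. (v x)\<^sup>2)"
    have "s\<^sup>2 \<le> sr\<^sup>2" using s by (intro power_mono) auto
    then have \<sigma>: "\<sigma> \<in> {0..R}" using c by (simp add: \<sigma>_def R_def)
    have tail: "integral {x..1} (\<lambda>x. (v x)\<^sup>2) \<le> ?V" if "x \<in> {0..1}" for x
      using that by (intro integral_subset_le integrable_continuous_real continuous_intros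
          cv continuous_on_subset[OF cv]) auto
    have V0: "?V \<ge> 0" by (intro integral_nonneg integrable_continuous_real continuous_intros cv) auto
    have AR: "(A * \<sigma>)\<^sup>2 \<le> (A * R)\<^sup>2" using A \<sigma> by (intro power_mono mult_left_mono) auto
    have cs: "(A * \<sigma>)\<^sup>2 * 6 / s \<le> D * s"
    proof -
      have "(A * \<sigma>)\<^sup>2 * 6 / s = 6 * (A * c * s)\<^sup>2 * s"
        using s by (simp add: \<sigma>_def field_simps power2_eq_square)
      also have "\<dots> \<le> D * s"
        unfolding D_def using A c s by (intro mult_right_mono mult_left_mono power_mono) auto
      finally show ?thesis .
    qed
    have kv: "(integral {x..1} (\<lambda>y. k \<sigma> x y * v y))\<^sup>2 \<le> (A * \<sigma>)\<^sup>2 * integral {x..1} (\<lambda>y. (v y)\<^sup>2)"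
      if "x \<in> {0..1}" "k = bs_kernel \<or> k = bs_kernel_x" for x k
    proof (rule tail_integral_square_le[OF that(1)])
      show "continuous_on {x..1} (k \<sigma> x)" using that(2) by (auto intro!: continuous_intros)
      show "continuous_on {x..1} v" by (rule continuous_on_subset[OF cv]) (use that in auto)
      show "\<bar>k \<sigma> x y\<bar> \<le> A * \<sigma>" if "y \<in> {x..1}" for y
        using that \<open>k = bs_kernel \<or> k = bs_kernel_x\<close> \<open>x \<in> {0..1}\<close> by (auto intro!: kb \<sigma>[simplified] simp: \<sigma>[simplified])
    qed
    have cc: "continuous_on ({0..1} \<times> {0..1::real}) (\<lambda>(x, t). H x)" if "continuous_on {0..1} H" for H :: "real \<Rightarrow> real"
      unfolding split_beta by (rule continuous_on_compose2[OF that]) (auto intro!: continuous_intros)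
    have cw: "continuous_on {0..1} (backstep \<sigma> v)"
      using continuous_on_section(2)[OF backstep_joint_continuous(1)[OF continuous_on_const[of _ \<sigma>] cc[OF cv]], of 0]
      by simp
    have cw1: "continuous_on {0..1} (backstep1 \<sigma> v v1)"
      using continuous_on_section(2)[OF backstep_joint_continuous(2)[OF continuous_on_const[of _ \<sigma>] cc[OF cv] cc[OF cv1]], of 0]
      by simp
    note ci = integrable_continuous_real continuous_intros cv cv1 cw cw1
    show "integral {0..1} (\<lambda>x. (backstep \<sigma> v x)\<^sup>2) \<le> (2 + B) * ?V"
    proof -
      have "integral {0..1} (\<lambda>x. (backstep \<sigma> v x)\<^sup>2) \<le> integral {0..1} (\<lambda>x. 2 * (v x)\<^sup>2 + (B * ?V) * 1 + 0 * 0)"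
      proof (intro integral_le ci)
        fix x :: real assume x: "x \<in> {0..1}"
        have "(backstep \<sigma> v x)\<^sup>2 \<le> 2 * (v x)\<^sup>2 + 2 * (integral {x..1} (\<lambda>y. bs_kernel \<sigma> x y * v y))\<^sup>2"
          using square_add_le2[of "v x" "- integral {x..1} (\<lambda>y. bs_kernel \<sigma> x y * v y)"] by (simp add: backstep_def)
        also have "(integral {x..1} (\<lambda>y. bs_kernel \<sigma> x y * v y))\<^sup>2 \<le> (A * \<sigma>)\<^sup>2 * integral {x..1} (\<lambda>y. (v y)\<^sup>2)"
          by (rule kv[OF x]) simp
        also have "\<dots> \<le> (A * R)\<^sup>2 * ?V" using AR tail[OF x] x
          by (intro mult_mono integral_nonneg integrable_continuous_real continuous_intros continuous_on_subset[OF cv]) auto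
        finally show "(backstep \<sigma> v x)\<^sup>2 \<le> 2 * (v x)\<^sup>2 + (B * ?V) * 1 + 0 * 0" by (simp add: B_def)
      qed
      also have "\<dots> = 2 * ?V + (B * ?V) * integral {0..1} (\<lambda>x::real. 1) + 0 * integral {0..1} (\<lambda>x::real. 0)"
        by (rule integral_linear_combination3; intro ci)
      finally show ?thesis by (simp add: algebra_simps)
    qed
    show "?V \<le> 4 * exp (2 * B + 1) * integral {0..1} (\<lambda>x. (backstep \<sigma> v x)\<^sup>2)"
    proof (rule volterra_inverse_bound[OF cv cw B])
      fix x :: real assume x: "x \<in> {0..1}"
      have "(v x)\<^sup>2 \<le> 2 * (backstep \<sigma> v x)\<^sup>2 + 2 * (integral {x..1} (\<lambda>y. bs_kernel \<sigma> x y * v y))\<^sup>2"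
        using square_add_le2[of "backstep \<sigma> v x" "integral {x..1} (\<lambda>y. bs_kernel \<sigma> x y * v y)"] by (simp add: backstep_def)
      also have "(integral {x..1} (\<lambda>y. bs_kernel \<sigma> x y * v y))\<^sup>2 \<le> (A * \<sigma>)\<^sup>2 * integral {x..1} (\<lambda>y. (v y)\<^sup>2)"
        by (rule kv[OF x]) simp
      also have "\<dots> \<le> (A * R)\<^sup>2 * integral {x..1} (\<lambda>y. (v y)\<^sup>2)" using AR x
        by (intro mult_right_mono integral_nonneg integrable_continuous_real continuous_intros continuous_on_subset[OF cv]) auto
      finally show "(v x)\<^sup>2 \<le> 2 * (backstep \<sigma> v x)\<^sup>2 + B * integral {x..1} (\<lambda>y. (v y)\<^sup>2)" by (simp add: B_def)
    qed
    have deriv_bound: "integral {0..1} (\<lambda>x. (f x)\<^sup>2) / s \<le> 3 * (integral {0..1} (\<lambda>x. (g x)\<^sup>2) / s) + D * (s * ?V)"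
      if cf: "continuous_on {0..1} f" and cg: "continuous_on {0..1} g"
        and fg: "\<And>x. x \<in> {0..1} \<Longrightarrow> \<bar>f x - g x\<bar> = \<bar>\<sigma> * x / 2 * v x - integral {x..1} (\<lambda>y. bs_kernel_x \<sigma> x y * v y)\<bar>"
      for f g :: "real \<Rightarrow> real"
    proof -
      have "integral {0..1} (\<lambda>x. (f x)\<^sup>2)
        \<le> integral {0..1} (\<lambda>x. 3 * (g x)\<^sup>2 + (3 * (A * \<sigma>)\<^sup>2) * (v x)\<^sup>2 + (3 * (A * \<sigma>)\<^sup>2 * ?V) * 1)"
      proof (intro integral_le ci cf cg)
        fix x :: real assume x: "x \<in> {0..1}"
        define r where "r = \<sigma> * x / 2 * v x"
        define q where "q = integral {x..1} (\<lambda>y. bs_kernel_x \<sigma> x y * v y)"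
        have "f x = g x + r + - q \<or> f x = g x + - r + q"
          using fg[OF x] unfolding r_def[symmetric] q_def[symmetric] by linarith
        then have "(f x)\<^sup>2 \<le> 3 * (g x)\<^sup>2 + 3 * r\<^sup>2 + 3 * q\<^sup>2"
          using square_add_le3[of "g x" r "- q"] square_add_le3[of "g x" "- r" q] by auto
        moreover have "r\<^sup>2 \<le> (A * \<sigma>)\<^sup>2 * (v x)\<^sup>2"
        proof -
          have "\<sigma> * (x / 2) \<le> \<sigma> * A" using x \<sigma> A by (intro mult_left_mono) auto
          then have "(\<sigma> * x / 2)\<^sup>2 \<le> (A * \<sigma>)\<^sup>2" using x \<sigma> by (intro power_mono) (auto simp: mult.commute)
          then show ?thesis unfolding r_def power_mult_distrib[of _ "v x"] by (intro mult_right_mono) auto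
        qed
        moreover have "q\<^sup>2 \<le> (A * \<sigma>)\<^sup>2 * ?V"
          using kv[OF x, of bs_kernel_x] mult_left_mono[OF tail[OF x], of "(A * \<sigma>)\<^sup>2"] by (simp add: q_def)
        ultimately show "(f x)\<^sup>2 \<le> 3 * (g x)\<^sup>2 + (3 * (A * \<sigma>)\<^sup>2) * (v x)\<^sup>2 + (3 * (A * \<sigma>)\<^sup>2 * ?V) * 1"
          by simp
      qed
      also have "\<dots> = 3 * integral {0..1} (\<lambda>x. (g x)\<^sup>2) + (3 * (A * \<sigma>)\<^sup>2) * ?V
          + (3 * (A * \<sigma>)\<^sup>2 * ?V) * integral {0..1} (\<lambda>x::real. 1)"
        by (rule integral_linear_combination3; intro ci cg)
      also have "\<dots> = 3 * integral {0..1} (\<lambda>x. (g x)\<^sup>2) + (A * \<sigma>)\<^sup>2 * 6 * ?V" by simp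
      finally have "integral {0..1} (\<lambda>x. (f x)\<^sup>2) / s
        \<le> (3 * integral {0..1} (\<lambda>x. (g x)\<^sup>2) + (A * \<sigma>)\<^sup>2 * 6 * ?V) / s"
        using s by (intro divide_right_mono) auto
      also have "\<dots> = 3 * (integral {0..1} (\<lambda>x. (g x)\<^sup>2) / s) + ((A * \<sigma>)\<^sup>2 * 6 / s) * ?V"
        by (simp add: add_divide_distrib)
      also have "\<dots> \<le> 3 * (integral {0..1} (\<lambda>x. (g x)\<^sup>2) / s) + (D * s) * ?V"
        using mult_right_mono[OF cs V0] by simp
      finally show ?thesis by simp
    qed
    show "integral {0..1} (\<lambda>x. (backstep1 \<sigma> v v1 x)\<^sup>2) / s
         \<le> 3 * (integral {0..1} (\<lambda>x. (v1 x)\<^sup>2) / s) + D * (s * ?V)"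
      by (rule deriv_bound[OF cw1 cv1]) (simp add: backstep1_def)
    show "integral {0..1} (\<lambda>x. (v1 x)\<^sup>2) / s
         \<le> 3 * (integral {0..1} (\<lambda>x. (backstep1 \<sigma> v v1 x)\<^sup>2) / s) + D * (s * ?V)"
      by (rule deriv_bound[OF cv1 cw1]) (simp add: backstep1_def)
  qed
  define L where "L = 4 * exp (2 * B + 1)"
  have L: "L > 0" by (simp add: L_def)
  have sq: "0 \<le> integral {0..1} (\<lambda>x. (f x)\<^sup>2)" for f :: "real \<Rightarrow> real"
    by (cases "(\<lambda>x. (f x)\<^sup>2) integrable_on {0..1}") (auto intro: integral_nonneg simp: not_integrable_integral)
  show thesis
  proof (rule that[of "5 + B + D" "3 + (1 + D) * L"])
    show "5 + B + D > 0" "3 + (1 + D) * L > 0" using B D L by (auto intro!: add_pos_nonneg)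
  next
    fix s and v v1 :: "real \<Rightarrow> real" assume H: "0 < s" "s \<le> sr" "continuous_on {0..1} v" "continuous_on {0..1} v1"
    let ?V = "integral {0..1} (\<lambda>x. (v x)\<^sup>2)" and ?V1 = "integral {0..1} (\<lambda>x. (v1 x)\<^sup>2)"
    let ?W = "integral {0..1} (\<lambda>x. (backstep (c * s\<^sup>2) v x)\<^sup>2)"
    let ?W1 = "integral {0..1} (\<lambda>x. (backstep1 (c * s\<^sup>2) v v1 x)\<^sup>2)"
    note m = main[OF H refl]
    have pos: "0 \<le> s * ?V" "0 \<le> ?V1 / s" "0 \<le> s * ?W" "0 \<le> ?W1 / s"
      using H(1) sq by (simp_all add: mult_nonneg_nonneg divide_nonneg_pos)
    have "s * ?W \<le> (2 + B) * (s * ?V)" using mult_left_mono[OF m(1), of s] H(1) by (simp add: algebra_simps)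
    with m(3) have "s * ?W + ?W1 / s \<le> (2 + B + D) * (s * ?V) + 3 * (?V1 / s)" by (simp add: algebra_simps)
    also have "\<dots> \<le> (5 + B + D) * (s * ?V) + (5 + B + D) * (?V1 / s)"
      using pos B D by (intro add_mono mult_right_mono) auto
    finally show "scaled_energy s (backstep (c * s\<^sup>2) v) (backstep1 (c * s\<^sup>2) v v1) \<le> (5 + B + D) * scaled_energy s v v1"
      by (simp add: scaled_energy_def algebra_simps)
    have sV: "s * ?V \<le> L * (s * ?W)" using mult_left_mono[OF m(2), of s] H(1) by (simp add: L_def algebra_simps)
    have "s * ?V + ?V1 / s \<le> (1 + D) * (s * ?V) + 3 * (?W1 / s)" using m(4) by (simp add: algebra_simps)
    also have "\<dots> \<le> (1 + D) * (L * (s * ?W)) + 3 * (?W1 / s)"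
      using sV D by (intro add_right_mono mult_left_mono) auto
    also have "\<dots> \<le> (3 + (1 + D) * L) * (s * ?W) + (3 + (1 + D) * L) * (?W1 / s)"
      unfolding mult.assoc[symmetric, of "1 + D" L "s * ?W"] using pos D L by (intro add_mono mult_right_mono) auto
    finally show "scaled_energy s v v1
        \<le> (3 + (1 + D) * L) * scaled_energy s (backstep (c * s\<^sup>2) v) (backstep1 (c * s\<^sup>2) v v1)"
      by (simp add: scaled_energy_def algebra_simps)
  qed
qed

section \<open>Decay of the transformed error\<close>

text \<open>
  The transform of the rescaled error solves the target system. The diffusion
  coefficient is \<open>lam / c\<close>, and \<open>\<sigma> = c s\<^sup>2\<close> satisfies \<open>\<sigma>' = 2 (s' / s) \<sigma>\<close>, which is the form of the time
  dependence required by the scaling relation of the kernel.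
\<close>

lemma scaled_error_system_decay:
  fixes v v1 v2 :: "real \<Rightarrow> real \<Rightarrow> real" and s s' :: "real \<Rightarrow> real" and c lam :: real
  assumes c: "c > 0" and lam: "lam > 0" and s_pos: "\<And>t. t \<ge> 0 \<Longrightarrow> s t > 0"
    and cs: "continuous_on {0..} s"
    and ds: "\<And>t. t > 0 \<Longrightarrow> (s has_real_derivative s' t) (at t)"
    and cs': "continuous_on {0<..} s'"
    and s'_nonneg: "\<And>t. t > 0 \<Longrightarrow> s' t \<ge> 0"
    and cv: "continuous_on ({0..1} \<times> {0..}) (\<lambda>(x, t). v x t)"
    and cv1: "continuous_on ({0..1} \<times> {0..}) (\<lambda>(x, t). v1 x t)"
    and cv2: "continuous_on ({0..1} \<times> {0<..}) (\<lambda>(x, t). v2 x t)"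
    and dv: "\<And>x t. x \<in> {0..1} \<Longrightarrow> t > 0 \<Longrightarrow>
      ((\<lambda>x. v x t) has_real_derivative v1 x t) (at x within {0..1})"
    and dv1: "\<And>x t. x \<in> {0..1} \<Longrightarrow> t > 0 \<Longrightarrow>
      ((\<lambda>x. v1 x t) has_real_derivative v2 x t) (at x within {0..1})"
    and dvt: "\<And>x t. x \<in> {0..1} \<Longrightarrow> t > 0 \<Longrightarrow> ((\<lambda>t. v x t) has_real_derivative
      lam / (c * (s t)\<^sup>2) * v2 x t + x * (s' t / s t) * v1 x t
        + lam * bessel_ser (c * (s t)\<^sup>2 * (1 - x\<^sup>2)) * v1 1 t) (at t)"
    and bc: "\<And>t. t > 0 \<Longrightarrow> v 1 t = 0" "\<And>t. t > 0 \<Longrightarrow> v1 0 t = 0"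
  defines "E \<equiv> \<lambda>t. scaled_energy (s t) (backstep (c * (s t)\<^sup>2) (\<lambda>x. v x t))
      (backstep1 (c * (s t)\<^sup>2) (\<lambda>x. v x t) (\<lambda>x. v1 x t))"
  assumes t: "t \<ge> 0"
  shows "E t \<le> exp (- 2 * lam * t) * E 0"
proof -
  define \<sigma> where "\<sigma> t = c * (s t)\<^sup>2" for t
  define b where "b t = s' t / s t" for t
  define G where "G x t = lam / \<sigma> t * v2 x t + x * b t * v1 x t + lam * bessel_ser (\<sigma> t * (1 - x\<^sup>2)) * v1 1 t" for x t
  define w where "w x t = backstep (\<sigma> t) (\<lambda>x. v x t) x" for x t
  define w1 where "w1 x t = backstep1 (\<sigma> t) (\<lambda>x. v x t) (\<lambda>x. v1 x t) x" for x t
  define w2 where "w2 x t = backstep2 (\<sigma> t) (\<lambda>x. v x t) (\<lambda>x. v1 x t) (\<lambda>x. v2 x t) x" for x t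
  define wt where "wt x t = lam / c / (s t)\<^sup>2 * w2 x t + x * (s' t / s t) * w1 x t - lam * w x t" for x t
  \<comment> \<open>The coefficients of the differential equation are continuous only for positive times, whereas \<open>w\<close>
    and \<open>w1\<close> are continuous up to \<open>t = 0\<close>.\<close>
  have T: "open {0::real<..}" "convex {0::real<..}" by auto
  have sub: "{0<..} \<subseteq> {0::real..}" "{0..1} \<times> {0<..} \<subseteq> {0..1::real} \<times> {0::real..}" by auto
  have \<sigma>_pos: "\<sigma> t > 0" if "t \<ge> 0" for t using s_pos[OF that] c by (simp add: \<sigma>_def)
  have c\<sigma>: "continuous_on {0..} \<sigma>" unfolding \<sigma>_def by (intro continuous_intros cs)
  have c\<sigma>p: "continuous_on {0<..} \<sigma>" by (rule continuous_on_subset[OF c\<sigma> sub(1)])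
  have cvp: "continuous_on ({0..1} \<times> {0<..}) (\<lambda>(x, t). v x t)" by (rule continuous_on_subset[OF cv sub(2)])
  have cv1p: "continuous_on ({0..1} \<times> {0<..}) (\<lambda>(x, t). v1 x t)" by (rule continuous_on_subset[OF cv1 sub(2)])
  have csp: "continuous_on {0<..} s" by (rule continuous_on_subset[OF cs sub(1)])
  have cb: "continuous_on {0<..} b"
    unfolding b_def by (rule continuous_on_divide[OF cs' csp]) (use s_pos in \<open>auto simp: less_le\<close>)
  have cw: "continuous_on ({0..1} \<times> {0..}) (\<lambda>(x, t). w x t)"
    unfolding w_def by (rule backstep_joint_continuous(1)[OF c\<sigma> cv])
  have cw1: "continuous_on ({0..1} \<times> {0..}) (\<lambda>(x, t). w1 x t)"
    unfolding w1_def by (rule backstep_joint_continuous(2)[OF c\<sigma> cv cv1])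
  have cw2: "continuous_on ({0..1} \<times> {0<..}) (\<lambda>(x, t). w2 x t)"
    unfolding w2_def by (rule backstep_joint_continuous(3)[OF c\<sigma>p cvp cv1p cv2])
  have cla: "continuous_on {0<..} (\<lambda>t. lam / \<sigma> t)"
    by (intro continuous_on_divide continuous_on_const c\<sigma>p) (use \<sigma>_pos in \<open>auto simp: less_le\<close>)
  have clb: "continuous_on {0<..} (\<lambda>t. v1 1 t)"
    by (rule continuous_on_section(1)[OF cv1p]) simp
  have cG: "continuous_on ({0..1} \<times> {0<..}) (\<lambda>(x, t). G x t)"
    unfolding G_def split_beta
    by (intro continuous_on_add continuous_on_mult continuous_on_snd_arg[OF cla] continuous_on_snd_arg[OF cb]
        continuous_on_snd_arg[OF clb] cv2[unfolded split_beta] cv1p[unfolded split_beta]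
        continuous_on_bessel_ser continuous_on_snd_arg[OF c\<sigma>p] continuous_on_diff continuous_on_power
        continuous_on_const continuous_on_fst continuous_on_id)
  have cwt: "continuous_on ({0..1} \<times> {0<..}) (\<lambda>(x, t). wt x t)"
  proof -
    have *: "lam / c / (s t)\<^sup>2 = lam / \<sigma> t" for t by (simp add: \<sigma>_def)
    show ?thesis
      unfolding wt_def split_beta * b_def[symmetric]
      by (intro continuous_on_add continuous_on_diff continuous_on_mult continuous_on_snd_arg[OF cla]
          continuous_on_snd_arg[OF cb] cw2[unfolded split_beta]
          continuous_on_subset[OF cw sub(2), unfolded split_beta]
          continuous_on_subset[OF cw1 sub(2), unfolded split_beta]
          continuous_on_const continuous_on_fst continuous_on_id)
  qed
  have dw: "((\<lambda>x. w x t) has_real_derivative w1 x t) (at x within {0..1})"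
    if "x \<in> {0..1}" "t > 0" for x t
    unfolding w_def w1_def using backstep_has_derivative[OF that(1) dv[OF _ that(2)]] .
  have dw1: "((\<lambda>x. w1 x t) has_real_derivative w2 x t) (at x within {0..1})"
    if "x \<in> {0..1}" "t > 0" for x t
    unfolding w1_def w2_def using backstep1_has_derivative[OF that(1) dv[OF _ that(2)] dv1[OF _ that(2)]] .
  have d\<sigma>: "(\<sigma> has_real_derivative 2 * b t * \<sigma> t) (at t)" if "t \<in> {0<..}" for t
  proof -
    have "t > 0" "s t > 0" using that s_pos by auto
    then have "(\<sigma> has_real_derivative c * (2 * s t * s' t)) (at t)"
      unfolding \<sigma>_def by (auto intro!: derivative_eq_intros ds)
    also have "c * (2 * s t * s' t) = 2 * b t * \<sigma> t"
      using \<open>s t > 0\<close> by (simp add: b_def \<sigma>_def power2_eq_square)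
    finally show ?thesis .
  qed
  have dwt: "((\<lambda>t. w x t) has_real_derivative wt x t) (at t)" if x: "x \<in> {0..1}" and t: "t > 0" for x t
  proof -
    have t': "t \<in> {0<..}" using t by simp
    have "((\<lambda>t. backstep (\<sigma> t) (\<lambda>x. v x t) x) has_real_derivative
       (G x t - integral {x..1} (\<lambda>y. (2 * b t * \<sigma> t) * bs_kernel_s (\<sigma> t) x y * v y t + bs_kernel (\<sigma> t) x y * G y t))) (at t)"
    proof (rule backstep_has_time_derivative[OF T t' x d\<sigma> _ cvp cG])
      show "continuous_on {0<..} (\<lambda>t. 2 * b t * \<sigma> t)" by (intro continuous_intros cb c\<sigma>p)
      show "((\<lambda>t. v x t) has_real_derivative G x t) (at t)" if "x \<in> {0..1}" "t \<in> {0<..}" for x t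
        using dvt[of x t] that by (simp add: G_def \<sigma>_def b_def)
    qed
    moreover have "G x t - integral {x..1} (\<lambda>y. 2 * b t * \<sigma> t * bs_kernel_s (\<sigma> t) x y * v y t + bs_kernel (\<sigma> t) x y * G y t)
      = lam / \<sigma> t * w2 x t + x * b t * w1 x t - lam * w x t"
      unfolding G_def w_def w1_def w2_def
      by (rule backstep_target_equation[OF \<sigma>_pos x dv dv1 continuous_on_section(2)[OF cv2 t'] bc(1)])
        (use t in auto)
    ultimately show ?thesis
      unfolding w_def[symmetric] by (simp add: wt_def \<sigma>_def b_def)
  qed
  have "s t * integral {0..1} (\<lambda>x. (w x t)\<^sup>2) + integral {0..1} (\<lambda>x. (w1 x t)\<^sup>2) / s t
    \<le> exp (- 2 * lam * t) * (s 0 * integral {0..1} (\<lambda>x. (w x 0)\<^sup>2) + integral {0..1} (\<lambda>x. (w1 x 0)\<^sup>2) / s 0)"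
  proof (rule target_energy_decay[OF _ s_pos cs ds s'_nonneg cw cw1 cw2 cwt dw dw1 dwt _ _ _ t])
    show "lam / c > 0" using lam c by simp
    show "w 1 t = 0" if "t > 0" for t using bc(1)[OF that] by (simp add: w_def backstep_def)
    show "w1 0 t = 0" if "t > 0" for t using bc(2)[OF that] by (simp add: w1_def backstep1_def bs_kernel_x_def)
  qed (simp_all add: wt_def)
  then show ?thesis
    by (simp add: E_def scaled_energy_def w_def w1_def \<sigma>_def)
qed

section \<open>Monotonicity of the interface\<close>

lemma interior_minimum_second_derivative:
  fixes f f' :: "real \<Rightarrow> real"
  assumes x: "a < x" "x < b"
    and d: "\<And>y. y \<in> {a..b} \<Longrightarrow> (f has_real_derivative f' y) (at y within {a..b})"
    and d2: "(f' has_real_derivative f'') (at x within {a..b})"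
    and min: "\<And>y. y \<in> {a..b} \<Longrightarrow> f x \<le> f y"
  shows "f'' \<ge> 0"
proof (rule ccontr)
  assume "\<not> f'' \<ge> 0"
  then have neg: "f'' < 0" by simp
  have din: "(f has_real_derivative f' y) (at y)" if "a < y" "y < b" for y
    using d[of y] that at_within_Icc_at[OF that] by simp
  have "f' x = 0"
    by (rule DERIV_local_min[OF din[OF x], of "min (x - a) (b - x)"])
      (use x in \<open>auto intro!: min simp: abs_le_iff abs_less_iff\<close>)
  obtain h0 where h0: "h0 > 0" "\<And>h. h > 0 \<Longrightarrow> x + h \<in> {a..b} \<Longrightarrow> h < h0 \<Longrightarrow> f' (x + h) < f' x"
    using has_real_derivative_neg_dec_right[OF d2 neg] by auto
  define h where "h = min (h0 / 2) ((b - x) / 2)"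
  have h: "h > 0" "h < h0" "x + h < b" using h0 x by (auto simp: h_def min_def field_simps)
  obtain z where z: "x < z" "z < x + h" "f (x + h) - f x = (x + h - x) * f' z"
    using MVT2[of x "x + h" f f'] h x din by force
  have "f' z < 0"
    using h0(2)[of "z - x"] z h x \<open>f' x = 0\<close> by auto
  then have "f (x + h) < f x" using z(3) h(1) mult_pos_neg[of h "f' z"] by simp
  then show False using min[of "x + h"] h x by auto
qed

text \<open>
  The perturbation \<open>\<epsilon> t\<close> makes the minimum principle strict. A negative minimum of
  \<open>T - T\<^sub>m + \<epsilon> t\<close> over the domain up to time \<open>t1\<close> cannot lie on the initial line or on the interface,
  where the function is nonnegative; nor at \<open>x = 0\<close>, where heat input makes \<open>T\<close> decrease into the
  domain; nor in the interior, where \<open>T\<^sub>t \<le> - \<epsilon>\<close> contradicts \<open>T\<^sub>t = \<alpha> T\<^sub>x\<^sub>x \<ge> 0\<close>.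
\<close>

lemma stefan_maximum_principle:
  assumes sol: "stefan_solution \<alpha> \<beta> k Tm qc T0 s0 T Tx Txx Tt s s'"
    and pos: "\<alpha> > 0" "k > 0"
    and T0: "\<And>x. x \<in> {0..s0} \<Longrightarrow> Tm \<le> T0 x"
    and qc: "\<And>t. t > 0 \<Longrightarrow> qc t > 0"
    and s_pos: "\<And>t. 0 \<le> t \<Longrightarrow> t \<le> t1 \<Longrightarrow> s t > 0"
    and t2: "0 \<le> t2" "t2 \<le> t1" and x2: "x2 \<in> {0..s t2}"
  shows "Tm \<le> T x2 t2"
proof (rule ccontr)
  assume "\<not> Tm \<le> T x2 t2"
  \<comment> \<open>Small enough to keep the value at \<open>(x2, t2)\<close> negative; the summand 1 covers \<open>t2 = 0\<close>.\<close>
  define \<epsilon> where "\<epsilon> = (Tm - T x2 t2) / (2 * (t2 + 1))"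
  have \<epsilon>: "\<epsilon> > 0" using \<open>\<not> Tm \<le> T x2 t2\<close> t2 by (simp add: \<epsilon>_def)
  have "\<epsilon> * t2 < \<epsilon> * (2 * (t2 + 1))" using \<epsilon> t2 by (intro mult_strict_left_mono) auto
  also have "\<dots> = Tm - T x2 t2" using t2 by (simp add: \<epsilon>_def)
  finally have neg2: "T x2 t2 - Tm + \<epsilon> * t2 < 0" by simp
  have cl: "classical_on s T Tx Txx Tt" and cs: "continuous_on {0..} s"
    using sol by (auto simp: stefan_solution_def)
  define z where "z = (\<lambda>p. T (fst p) (snd p) - Tm + \<epsilon> * snd p)"
  \<comment> \<open>The domain up to time \<open>t1\<close>, written as a continuous image of a rectangle to see that it is
    compact.\<close>
  define D where "D = (\<lambda>p. (fst p * s (snd p), snd p)) ` ({0..1} \<times> {0..t1})"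
  have "compact D"
    unfolding D_def
    by (intro compact_continuous_image compact_Times compact_Icc continuous_intros
        continuous_on_compose2[OF cs]) auto
  have D_iff: "(x, t) \<in> D \<longleftrightarrow> 0 \<le> t \<and> t \<le> t1 \<and> 0 \<le> x \<and> x \<le> s t" for x t
  proof
    assume "(x, t) \<in> D"
    then obtain q where q: "q \<in> {0..1} \<times> {0..t1}" "(x, t) = (fst q * s (snd q), snd q)"
      unfolding D_def by blast
    then have "0 \<le> t" "t \<le> t1" "x = fst q * s t" "0 \<le> fst q" "fst q \<le> 1" by auto
    then show "0 \<le> t \<and> t \<le> t1 \<and> 0 \<le> x \<and> x \<le> s t"
      using s_pos[of t] mult_right_mono[of "fst q" 1 "s t"] by auto
  next
    assume *: "0 \<le> t \<and> t \<le> t1 \<and> 0 \<le> x \<and> x \<le> s t"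
    then have "s t > 0" using s_pos by auto
    then have "(x, t) = (x / s t * s t, t)" "x / s t \<in> {0..1}" using * by auto
    then show "(x, t) \<in> D" unfolding D_def using * by (intro image_eqI[of _ _ "(x / s t, t)"]) auto
  qed
  have "continuous_on D z"
    unfolding z_def
    by (intro continuous_intros continuous_on_subset[of "moving_domain s" _ D])
      (use cl D_iff in \<open>auto simp: classical_on_def split_beta moving_domain_def\<close>)
  moreover have "(x2, t2) \<in> D" using t2 x2 by (simp add: D_iff)
  ultimately obtain p where p: "p \<in> D" "\<And>r. r \<in> D \<Longrightarrow> z p \<le> z r"
    using continuous_attains_inf[OF \<open>compact D\<close>] by blast
  obtain x t where xt: "p = (x, t)" by (cases p)
  have D: "0 \<le> t" "t \<le> t1" "0 \<le> x" "x \<le> s t" using p(1) by (auto simp: xt D_iff)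
  have min: "T x t + \<epsilon> * t \<le> T y r + \<epsilon> * r" if "0 \<le> r" "r \<le> t1" "0 \<le> y" "y \<le> s r" for y r
    using p(2)[of "(y, r)"] that by (simp add: xt D_iff z_def)
  have neg: "T x t - Tm + \<epsilon> * t < 0"
    using p(2)[OF \<open>(x2, t2) \<in> D\<close>] neg2 by (simp add: xt z_def)
  have t: "t > 0"
  proof (rule ccontr)
    assume "\<not> t > 0"
    then have "t = 0" using D by simp
    then have "T x t = T0 x" "x \<in> {0..s0}" using sol D by (auto simp: stefan_solution_def)
    then show False using T0[of x] neg \<open>t = 0\<close> by simp
  qed
  have st: "s t > 0" using s_pos D by auto
  have dT: "((\<lambda>y. T y t) has_real_derivative Tx y t) (at y within {0..s t})" if "y \<in> {0..s t}" for y
    using cl t that by (simp add: classical_on_def)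
  have xs: "x < s t"
  proof (rule ccontr)
    assume "\<not> x < s t"
    then have "T x t = Tm" using D t sol by (simp add: stefan_solution_def)
    then show False using neg mult_pos_pos[OF \<epsilon> t] by simp
  qed
  have x0: "x > 0"
  proof (rule ccontr)
    assume "\<not> x > 0"
    then have x: "x = 0" using D by simp
    have "- k * Tx 0 t > 0" using sol qc[OF t] t by (simp add: stefan_solution_def)
    then have "Tx 0 t < 0" using pos(2) by (simp add: mult_less_0_iff)
    from has_real_derivative_neg_dec_right[OF dT this] obtain d where
      d: "d > 0" "\<And>h. h > 0 \<Longrightarrow> 0 + h \<in> {0..s t} \<Longrightarrow> h < d \<Longrightarrow> T (0 + h) t < T 0 t"
      using st by auto
    define h where "h = min (d / 2) (s t)"
    have "h > 0" "h \<le> s t" "h < d" using d(1) st by (auto simp: h_def)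
    then show False using d(2)[of h] min[of t h] D by (simp add: x)
  qed
  have "Txx x t \<ge> 0"
  proof (rule interior_minimum_second_derivative[OF x0 xs dT])
    show "((\<lambda>y. Tx y t) has_real_derivative Txx x t) (at x within {0..s t})"
      using cl t D by (simp add: classical_on_def)
    show "T x t \<le> T y t" if "y \<in> {0..s t}" for y using min[of t y] that D by simp
  qed
  moreover have "Tt x t + \<epsilon> \<le> 0"
  proof (rule ccontr)
    assume "\<not> Tt x t + \<epsilon> \<le> 0"
    then have "Tt x t + \<epsilon> > 0" by simp
    have "((\<lambda>\<tau>. T x \<tau>) has_real_derivative Tt x t) (at t within {\<tau>. (x, \<tau>) \<in> moving_domain s})"
      using cl t D by (simp add: classical_on_def)
    then have "((\<lambda>\<tau>. T x \<tau> + \<epsilon> * \<tau>) has_real_derivative Tt x t + \<epsilon>) (at t within {\<tau>. (x, \<tau>) \<in> moving_domain s})"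
      by (auto intro!: derivative_eq_intros)
    from has_real_derivative_pos_inc_left[OF this \<open>Tt x t + \<epsilon> > 0\<close>] obtain d where
      d: "d > 0" "\<And>h. h > 0 \<Longrightarrow> (x, t - h) \<in> moving_domain s \<Longrightarrow> h < d \<Longrightarrow> T x (t - h) + \<epsilon> * (t - h) < T x t + \<epsilon> * t"
      by auto
    have "isCont s t" using sol t by (auto simp: stefan_solution_def intro: DERIV_isCont)
    then have "(s \<longlongrightarrow> s t) (at t)" by (simp add: isCont_def)
    from order_tendstoD(1)[OF this xs] obtain e where
      e: "e > 0" "\<And>\<tau>. \<tau> \<noteq> t \<Longrightarrow> dist \<tau> t < e \<Longrightarrow> x < s \<tau>"
      unfolding eventually_at by auto
    define h where "h = min (d / 2) (min (e / 2) t)"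
    have h: "h > 0" "h < d" "h < e" "h \<le> t" using d(1) e(1) t by (auto simp: h_def min_def)
    then have "x < s (t - h)" using e(2)[of "t - h"] by (simp add: dist_real_def)
    then show False
      using d(2)[of h] min[of "t - h" x] h D by (simp add: moving_domain_def)
  qed
  moreover have "Tt x t = \<alpha> * Txx x t" using sol t D by (simp add: stefan_solution_def)
  ultimately show False using \<epsilon> pos(1) mult_nonneg_nonneg[of \<alpha> "Txx x t"] by linarith
qed

text \<open>
  The maximum principle presupposes \<open>s > 0\<close>, and positivity of \<open>s\<close> follows from its monotonicity.
  The circle is broken at the first zero of \<open>s\<close>: up to that time \<open>s\<close> is nondecreasing and thus
  at least \<open>s0 > 0\<close>.
\<close>

lemma stefan_interface_monotone:
  assumes sol: "stefan_solution \<alpha> \<beta> k Tm qc T0 s0 T Tx Txx Tt s s'"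
    and pos: "\<alpha> > 0" "\<beta> > 0" "k > 0" "s0 > 0"
    and T0: "\<And>x. x \<in> {0..s0} \<Longrightarrow> Tm \<le> T0 x"
    and qc: "\<And>t. t > 0 \<Longrightarrow> qc t > 0"
  shows "t \<ge> 0 \<Longrightarrow> s t \<ge> s0" "t > 0 \<Longrightarrow> s' t \<ge> 0"
proof -
  have cs: "continuous_on {0..} s" and s_0: "s 0 = s0"
    and ds: "\<And>t. t > 0 \<Longrightarrow> (s has_real_derivative s' t) (at t)"
    using sol by (auto simp: stefan_solution_def)
  have s': "s' t \<ge> 0" if t: "t > 0" and sp: "\<And>\<tau>. 0 \<le> \<tau> \<Longrightarrow> \<tau> \<le> t \<Longrightarrow> s \<tau> > 0" for t
  proof -
    have st: "s t > 0" using sp t by simp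
    have "Tx (s t) t \<le> 0"
    proof (rule ccontr)
      assume "\<not> Tx (s t) t \<le> 0"
      then have p: "Tx (s t) t > 0" by simp
      have "((\<lambda>y. T y t) has_real_derivative Tx (s t) t) (at (s t) within {0..s t})"
        using sol t st by (simp add: stefan_solution_def classical_on_def)
      from has_real_derivative_pos_inc_left[OF this p] obtain d where
        d: "d > 0" "\<And>h. h > 0 \<Longrightarrow> s t - h \<in> {0..s t} \<Longrightarrow> h < d \<Longrightarrow> T (s t - h) t < T (s t) t"
        by auto
      define h where "h = min (d / 2) (s t)"
      have h: "h > 0" "h \<le> s t" "h < d" using d(1) st by (auto simp: h_def)
      have "Tm \<le> T (s t - h) t"
        by (rule stefan_maximum_principle[OF sol pos(1,3) T0 qc sp _ order_refl]) (use t h in auto)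
      moreover have "T (s t) t = Tm" using sol t by (simp add: stefan_solution_def)
      ultimately show False using d(2)[of h] h by simp
    qed
    moreover have "s' t = - \<beta> * Tx (s t) t" using sol t by (simp add: stefan_solution_def)
    ultimately show ?thesis using pos(2) by (simp add: mult_nonneg_nonpos)
  qed
  have mono: "s t \<ge> s0" if t: "t \<ge> 0" and sp: "\<And>\<tau>. 0 \<le> \<tau> \<Longrightarrow> \<tau> < t \<Longrightarrow> s \<tau> > 0" for t
  proof -
    have "s 0 \<le> s t"
    proof (rule DERIV_nonneg_imp_increasing_open[OF t])
      fix \<tau> assume "0 < \<tau>" "\<tau> < t"
      then show "\<exists>y. (s has_real_derivative y) (at \<tau>) \<and> 0 \<le> y"
        using ds s' sp by (intro exI[of _ "s' \<tau>"]) auto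
    next
      show "continuous_on {0..t} s" by (rule continuous_on_subset[OF cs]) auto
    qed
    then show ?thesis by (simp add: s_0)
  qed
  have s_pos: "s t > 0" if "t \<ge> 0" for t
  proof (rule ccontr)
    assume "\<not> s t > 0"
    define N where "N = {0..} \<inter> s -` {..0}"
    have "closed N"
      unfolding N_def by (intro continuous_closed_preimage cs) auto
    moreover have "N \<noteq> {}" "bdd_below N" using \<open>\<not> s t > 0\<close> that by (auto simp: N_def)
    ultimately have "Inf N \<in> N" by (intro closed_contains_Inf)
    have "s \<tau> > 0" if "0 \<le> \<tau>" "\<tau> < Inf N" for \<tau>
      using cInf_lower[OF _ \<open>bdd_below N\<close>, of \<tau>] that by (auto simp: N_def not_le[symmetric])
    then have "s (Inf N) \<ge> s0" using \<open>Inf N \<in> N\<close> by (intro mono) (auto simp: N_def)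
    then show False using \<open>Inf N \<in> N\<close> pos(4) by (simp add: N_def)
  qed
  show "t \<ge> 0 \<Longrightarrow> s t \<ge> s0" by (rule mono) (use s_pos in auto)
  show "t > 0 \<Longrightarrow> s' t \<ge> 0" by (rule s') (use s_pos in auto)
qed

section \<open>Passage to the unit interval\<close>

text \<open>
  For \<open>\<xi> < 1\<close> the point \<open>(\<xi> s(t), t)\<close> has a neighbourhood in the domain that is a rectangle, and
  there the Hadamard quotient in time applies. At the interface itself there is no
  such rectangle; that case is covered by \<open>time_derivative_extends_to_boundary\<close>.
\<close>

lemma moving_chain_rule:
  assumes cl: "classical_on s u ux uxx ut"
    and cs: "continuous_on {0..} s"
    and ds: "(s has_real_derivative s') (at t)"
    and t: "t > 0" and st: "s t > 0" and \<xi>: "0 \<le> \<xi>" "\<xi> < 1"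
  shows "((\<lambda>\<tau>. u (\<xi> * s \<tau>) \<tau>) has_real_derivative
      ux (\<xi> * s t) t * (\<xi> * s') + ut (\<xi> * s t) t) (at t)"
proof -
  define x1 where "x1 = (1 + \<xi>) / 2 * s t"
  have x1: "\<xi> * s t < x1" "x1 < s t" "0 \<le> \<xi> * s t"
    using \<xi> st by (auto simp: x1_def)
  have "isCont s t" by (rule DERIV_isCont[OF ds])
  then have lim: "(s \<longlongrightarrow> s t) (at t)" by (simp add: isCont_def)
  have "\<forall>\<^sub>F \<tau> in at t. x1 < s \<tau>" by (rule order_tendstoD(1)[OF lim x1(2)])
  moreover have "\<forall>\<^sub>F \<tau> in at t. \<xi> * s \<tau> < x1"
    by (rule order_tendstoD(2)[OF tendsto_mult_left[OF lim] x1(1)])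
  ultimately have "\<forall>\<^sub>F \<tau> in at t. x1 < s \<tau> \<and> \<xi> * s \<tau> < x1" by (rule eventually_conj)
  then obtain d where d: "d > 0" "\<And>\<tau>. \<tau> \<noteq> t \<Longrightarrow> dist \<tau> t < d \<Longrightarrow> x1 < s \<tau> \<and> \<xi> * s \<tau> < x1"
    unfolding eventually_at by auto
  define \<delta> where "\<delta> = min d t"
  define I where "I = {t - \<delta><..<t + \<delta>}"
  have \<delta>: "\<delta> > 0" using d t by (simp add: \<delta>_def)
  have I: "open I" "convex I" "t \<in> I" using \<delta> by (auto simp: I_def)
  have I_s: "\<tau> > 0" "x1 < s \<tau>" "\<xi> * s \<tau> < x1" "0 \<le> \<xi> * s \<tau>" if "\<tau> \<in> I" for \<tau>
  proof -
    show "\<tau> > 0" using that by (auto simp: I_def \<delta>_def)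
    have "x1 < s \<tau> \<and> \<xi> * s \<tau> < x1"
      using d(2)[of \<tau>] x1 that by (cases "\<tau> = t") (auto simp: I_def \<delta>_def dist_real_def)
    moreover have "0 \<le> x1" using x1 by linarith
    ultimately show "x1 < s \<tau>" "\<xi> * s \<tau> < x1" "0 \<le> \<xi> * s \<tau>" using \<xi> by auto
  qed
  have ut_cont: "continuous_on ({0..x1} \<times> I) (\<lambda>(x, t). ut x t)"
    by (rule continuous_on_subset[of "moving_domain s \<inter> {(x, t). 0 < t}"])
      (use cl I_s in \<open>auto simp: classical_on_def moving_domain_def less_imp_le intro: order_trans\<close>)
  have q_cont: "continuous_on ({0..x1} \<times> I) (\<lambda>(x, \<tau>). hadamard_quot ut t x \<tau>)"
    by (rule hadamard_quot_continuous[OF I(2,3) ut_cont])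
  have u_eq: "u x \<tau> = u x t + (\<tau> - t) * hadamard_quot ut t x \<tau>" if "x \<in> {0..x1}" "\<tau> \<in> I" for x \<tau>
  proof (rule hadamard_quot_eq[where f = u and p = x, OF I(2,3) that(2)])
    fix r assume r: "r \<in> I"
    have "x \<in> {0..s r}" "r > 0" using I_s[OF r] that(1) by auto
    then have "((\<lambda>\<tau>. u x \<tau>) has_real_derivative ut x r) (at r within {\<tau>. (x, \<tau>) \<in> moving_domain s})"
      using cl by (simp add: classical_on_def)
    then show "(u x has_real_derivative ut x r) (at r within I)"
      by (rule DERIV_subset) (use I_s that(1) in \<open>auto simp: moving_domain_def less_imp_le intro: order_trans\<close>)
  qed
  have c\<xi>: "continuous_on I (\<lambda>\<tau>. \<xi> * s \<tau>)"
    by (intro continuous_intros continuous_on_subset[OF cs]) (use I_s in \<open>auto simp: less_imp_le\<close>)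
  have "continuous_on I (\<lambda>\<tau>. hadamard_quot ut t (\<xi> * s \<tau>) \<tau>)"
    by (rule continuous_on_compose2[OF q_cont[unfolded split_beta], where f = "\<lambda>\<tau>. (\<xi> * s \<tau>, \<tau>)", simplified])
      (use I_s in \<open>auto intro!: continuous_intros c\<xi> simp: less_imp_le\<close>)
  then have d2: "((\<lambda>\<tau>. (\<tau> - t) * hadamard_quot ut t (\<xi> * s \<tau>) \<tau>) has_real_derivative
      hadamard_quot ut t (\<xi> * s t) t) (at t within I)"
    by (rule has_derivative_from_quotient[OF I(3)]) simp
  have d1: "((\<lambda>\<tau>. u (\<xi> * s \<tau>) t) has_real_derivative ux (\<xi> * s t) t * (\<xi> * s')) (at t within I)"
  proof -
    have "((\<lambda>y. u y t) has_real_derivative ux (\<xi> * s t) t) (at (\<xi> * s t) within {0..s t})"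
    proof -
      have "\<forall>x\<in>{0..s t}. ((\<lambda>y. u y t) has_real_derivative ux x t) (at x within {0..s t})"
        using cl t by (simp add: classical_on_def)
      then show ?thesis
        by (rule bspec) (rule atLeastAtMost_iff[THEN iffD2, OF conjI[OF x1(3) less_imp_le[OF less_trans[OF x1(1,2)]]]])
    qed
    then have "((\<lambda>y. u y t) has_real_derivative ux (\<xi> * s t) t)
        (at (\<xi> * s t) within (\<lambda>\<tau>. \<xi> * s \<tau>) ` I)"
      by (rule DERIV_subset) (use I_s x1 in \<open>fastforce simp: less_imp_le\<close>)
    from DERIV_image_chain[OF this, of "\<xi> * s'"]
    show ?thesis
      using has_field_derivative_at_within[OF DERIV_cmult[OF ds, of \<xi>]] by (simp add: o_def)
  qed
  have "((\<lambda>\<tau>. u (\<xi> * s \<tau>) t + (\<tau> - t) * hadamard_quot ut t (\<xi> * s \<tau>) \<tau>) has_real_derivative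
      ux (\<xi> * s t) t * (\<xi> * s') + ut (\<xi> * s t) t) (at t within I)"
    using DERIV_add[OF d1 d2] by simp
  then have "((\<lambda>\<tau>. u (\<xi> * s \<tau>) \<tau>) has_real_derivative
      ux (\<xi> * s t) t * (\<xi> * s') + ut (\<xi> * s t) t) (at t within I)"
    by (rule has_field_derivative_transform_within[OF _ zero_less_one I(3)])
      (use I_s in \<open>auto intro!: u_eq[symmetric] simp: less_imp_le\<close>)
  then show ?thesis by (simp add: at_within_open[OF I(3,1)])
qed

text \<open>
  The identity \<open>v x \<tau> = v x t + (\<tau> - t) q x \<tau>\<close>, where \<open>q\<close> is the Hadamard quotient of \<open>G\<close>, passes to the limit \<open>x = 1\<close> by
  continuity.
\<close>

lemma time_derivative_extends_to_boundary:
  fixes v G :: "real \<Rightarrow> real \<Rightarrow> real"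
  assumes S: "open S" "convex S" "t \<in> S"
    and cv: "continuous_on ({0..1} \<times> S) (\<lambda>(x, t). v x t)"
    and cG: "continuous_on ({0..1} \<times> S) (\<lambda>(x, t). G x t)"
    and d: "\<And>x t. 0 \<le> x \<Longrightarrow> x < 1 \<Longrightarrow> t \<in> S \<Longrightarrow> ((\<lambda>t. v x t) has_real_derivative G x t) (at t)"
    and x: "x \<in> {0..1}"
  shows "((\<lambda>t. v x t) has_real_derivative G x t) (at t)"
proof -
  let ?q = "hadamard_quot G t"
  have cq: "continuous_on ({0..1} \<times> S) (\<lambda>(x, \<tau>). ?q x \<tau>)"
    by (rule hadamard_quot_continuous[OF S(2,3) cG])
  have eq: "v x \<tau> = v x t + (\<tau> - t) * ?q x \<tau>" if "\<tau> \<in> S" for \<tau>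
  proof -
    have zero: "v y \<tau> - (v y t + (\<tau> - t) * ?q y \<tau>) = 0" if "y \<in> {0..<1}" for y
    proof -
      have y: "0 \<le> y" "y < 1" using that by auto
      have "v y \<tau> = v y t + (\<tau> - t) * ?q y \<tau>"
        by (rule hadamard_quot_eq[where f = v and p = y, OF S(2,3) \<open>\<tau> \<in> S\<close>])
          (rule has_field_derivative_at_within[OF d[OF y]])
      then show ?thesis by simp
    qed
    have "continuous_on {0..1} (\<lambda>y. v y \<tau> - (v y t + (\<tau> - t) * ?q y \<tau>))"
      by (intro continuous_on_diff continuous_on_add continuous_on_mult continuous_on_const
          continuous_on_section(2)[OF cv] continuous_on_section(2)[OF cq] S(3) that)
    then have cont: "continuous_on (closure {0..<1}) (\<lambda>y. v y \<tau> - (v y t + (\<tau> - t) * ?q y \<tau>))"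
      by simp
    have "v x \<tau> - (v x t + (\<tau> - t) * ?q x \<tau>) = 0"
      by (rule continuous_constant_on_closure[OF cont zero]) (use x in simp_all)
    then show ?thesis by simp
  qed
  have "((\<lambda>t. v x t) has_real_derivative ?q x t) (at t within S)"
    by (rule has_derivative_from_quotient[OF S(3) continuous_on_section(1)[OF cq x] eq])
  then show ?thesis by (simp add: at_within_open[OF S(3,1)])
qed

lemma H1_norm_sq_rescale:
  assumes l: "l > 0"
    and d: "\<And>x. x \<in> {0..l} \<Longrightarrow> (f has_real_derivative f' x) (at x within {0..l})"
    and cf': "continuous_on {0..l} f'"
  shows "H1_norm_sq l f = scaled_energy l (\<lambda>x. f (x * l)) (\<lambda>x. l * f' (x * l))"
proof -
  have cf: "continuous_on {0..l} f" by (rule DERIV_continuous_on[OF d])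
  have sc: "continuous_on {0..1} (\<lambda>x. g (x * l))" if "continuous_on {0..l} g" for g :: "real \<Rightarrow> real"
    by (rule continuous_on_compose2[OF that])
      (use l in \<open>auto intro!: continuous_intros mult_left_le_one_le\<close>)
  have "H1_norm_sq l f = integral {0..l} (\<lambda>x. (f x)\<^sup>2 + (f' x)\<^sup>2)"
    unfolding H1_norm_sq_def
  proof (rule integral_cong)
    fix x assume x: "x \<in> {0..l}"
    have "vector_derivative f (at x within {0..l}) = f' x"
      by (rule vector_derivative_within_closed_interval[OF l x])
        (use d[OF x] in \<open>simp add: has_real_derivative_iff_has_vector_derivative\<close>)
    then show "(f x)\<^sup>2 + (vector_derivative f (at x within {0..l}))\<^sup>2 = (f x)\<^sup>2 + (f' x)\<^sup>2" by simp
  qed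
  also have "\<dots> = integral {0..1} (\<lambda>x. l *\<^sub>R ((f (x * l))\<^sup>2 + (f' (x * l))\<^sup>2))"
  proof -
    have "((\<lambda>x. l *\<^sub>R ((f (x * l))\<^sup>2 + (f' (x * l))\<^sup>2)) has_integral
        integral {0 * l..1 * l} (\<lambda>x. (f x)\<^sup>2 + (f' x)\<^sup>2)) {0..1}"
      by (rule has_integral_substitution[where c = 0 and d = l])
        (use l in \<open>auto intro!: continuous_intros cf cf' derivative_eq_intros mult_left_le_one_le\<close>)
    from integral_unique[OF this] show ?thesis by simp
  qed
  also have "\<dots> = integral {0..1} (\<lambda>x. l * (f (x * l))\<^sup>2 + 1 / l * (l * f' (x * l))\<^sup>2 + 0 * 0)"
    using l by (simp add: algebra_simps power2_eq_square)
  also have "\<dots> = l * integral {0..1} (\<lambda>x. (f (x * l))\<^sup>2) + 1 / l * integral {0..1} (\<lambda>x. (l * f' (x * l))\<^sup>2)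
      + 0 * integral {0..1} (\<lambda>x::real. 0)"
    by (rule integral_linear_combination3) (intro continuous_intros sc cf cf')+
  finally show ?thesis by (simp add: scaled_energy_def)
qed

section \<open>Exponential stability of the observer error\<close>

lemma classical_on_diff:
  assumes "classical_on s u ux uxx ut" "classical_on s w wx wxx wt"
  shows "classical_on s (\<lambda>x t. u x t - w x t) (\<lambda>x t. ux x t - wx x t)
    (\<lambda>x t. uxx x t - wxx x t) (\<lambda>x t. ut x t - wt x t)"
  using assms unfolding classical_on_def split_beta
  by (auto intro!: continuous_on_diff DERIV_diff)

text \<open>
  The constants are \<open>\<kappa> = 2 \<lambda>\<close> and the product of the two norm equivalence constants. It remains to
  derive the rescaled error system from the plant and the observer.
\<close>

theorem theorem2:
  fixes \<alpha> \<beta> k Tm s\<^sub>r lam :: real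
  assumes "\<alpha> > 0" "\<beta> > 0" "k > 0" "s\<^sub>r > 0" "lam > 0"
  shows "\<exists>M>0. \<exists>\<kappa>>0.
    \<forall>qc T0 s0 T Tx Txx Tt s s' That Thatx Thatxx Thatt.
      stefan_solution \<alpha> \<beta> k Tm qc T0 s0 T Tx Txx Tt s s' \<longrightarrow>
      s0 > 0 \<longrightarrow>
      (\<exists>H>0. \<forall>x\<in>{0..s0}. 0 \<le> T0 x - Tm \<and> T0 x - Tm \<le> H * (s0 - x)) \<longrightarrow>
      observer_solution \<alpha> \<beta> k Tm lam qc s s' That Thatx Thatxx Thatt \<longrightarrow>
      (\<forall>t>0. qc t > 0 \<and> s t < s\<^sub>r) \<longrightarrow>
      (\<forall>t\<ge>0. H1_norm_sq (s t) (\<lambda>x. T x t - That x t)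
              \<le> M * exp (- \<kappa> * t) * H1_norm_sq (s 0) (\<lambda>x. T x 0 - That x 0))"
proof -
  define c where "c = lam / \<alpha>"
  have c: "c > 0" and \<alpha>c: "\<alpha> = lam / c" using assms by (simp_all add: c_def)
  obtain M1 M2 where M: "M1 > 0" "M2 > 0" and
    M1: "\<And>s (v :: real \<Rightarrow> real) v1. \<lbrakk>0 < s; s \<le> s\<^sub>r; continuous_on {0..1} v; continuous_on {0..1} v1\<rbrakk> \<Longrightarrow>
       scaled_energy s (backstep (c * s\<^sup>2) v) (backstep1 (c * s\<^sup>2) v v1) \<le> M1 * scaled_energy s v v1" and
    M2: "\<And>s (v :: real \<Rightarrow> real) v1. \<lbrakk>0 < s; s \<le> s\<^sub>r; continuous_on {0..1} v; continuous_on {0..1} v1\<rbrakk> \<Longrightarrow>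
       scaled_energy s v v1 \<le> M2 * scaled_energy s (backstep (c * s\<^sup>2) v) (backstep1 (c * s\<^sup>2) v v1)"
    using backstep_energy_equivalence[OF c assms(4)] by blast
  have pos: "M2 * M1 > 0" "2 * lam > 0" using M assms by simp_all
  show ?thesis
  proof (rule exI[of _ "M2 * M1"], rule conjI[OF pos(1)], rule exI[of _ "2 * lam"],
      rule conjI[OF pos(2)], intro allI impI)
    fix qc T0 :: "real \<Rightarrow> real" and s0 :: real and T Tx Txx Tt :: "real \<Rightarrow> real \<Rightarrow> real"
      and s s' :: "real \<Rightarrow> real" and U Ux Uxx Ut :: "real \<Rightarrow> real \<Rightarrow> real" and t :: real
    assume sol: "stefan_solution \<alpha> \<beta> k Tm qc T0 s0 T Tx Txx Tt s s'" and s0: "s0 > 0"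
      and T0: "\<exists>H>0. \<forall>x\<in>{0..s0}. 0 \<le> T0 x - Tm \<and> T0 x - Tm \<le> H * (s0 - x)"
      and obs: "observer_solution \<alpha> \<beta> k Tm lam qc s s' U Ux Uxx Ut"
      and con: "\<forall>t>0. qc t > 0 \<and> s t < s\<^sub>r" and t: "t \<ge> 0"
    note mono = stefan_interface_monotone[OF sol assms(1,2,3) s0]
    have s_ge: "s t \<ge> s0" if "t \<ge> 0" for t
      by (rule mono(1)[OF _ _ that]) (use T0 con in auto)
    have s'_nonneg: "s' t \<ge> 0" if "t > 0" for t
      by (rule mono(2)[OF _ _ that]) (use T0 con in auto)
    have s_pos: "s t > 0" if "t \<ge> 0" for t using s_ge[OF that] s0 by simp
    have cs: "continuous_on {0..} s" and ds: "\<And>t. t > 0 \<Longrightarrow> (s has_real_derivative s' t) (at t)"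
      and s_0: "s 0 = s0" using sol by (auto simp: stefan_solution_def)
    have s_le: "s t \<le> s\<^sub>r" if "t \<ge> 0" for t
    proof (cases "t = 0")
      case True
      have "s 0 \<le> s 1" using s_ge[of 1] s_0 by simp
      also have "s 1 < s\<^sub>r" using con by simp
      finally show ?thesis using True by simp
    qed (use con that in \<open>auto simp: less_imp_le\<close>)
    have clT: "classical_on s T Tx Txx Tt" using sol by (simp add: stefan_solution_def)
    have clU: "classical_on s U Ux Uxx Ut" using obs by (simp add: observer_solution_def)
    define u where "u x t = T x t - U x t" for x t
    define ux where "ux x t = Tx x t - Ux x t" for x t
    define uxx where "uxx x t = Txx x t - Uxx x t" for x t
    define ut where "ut x t = Tt x t - Ut x t" for x t
    have cl: "classical_on s u ux uxx ut" by (rule classical_on_diff[OF clT clU, folded u_def ux_def uxx_def ut_def])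
    have pde: "ut x t = \<alpha> * uxx x t + lam * s t * bessel_ser (c * ((s t)\<^sup>2 - x\<^sup>2)) * ux (s t) t"
      if t: "t > 0" and x: "x \<in> {0..s t}" for x t
    proof -
      have "x\<^sup>2 \<le> (s t)\<^sup>2" using x by (intro power_mono) auto
      then have "(sqrt (lam / \<alpha> * ((s t)\<^sup>2 - x\<^sup>2)))\<^sup>2 = c * ((s t)\<^sup>2 - x\<^sup>2)"
        using c by (simp add: c_def[symmetric])
      \<comment> \<open>In the domain the square root in the gain has a nonnegative argument, so \<open>\<phi>\<close> undoes it.\<close>
      then have gain: "observer_gain \<alpha> lam x (s t) = - lam * s t * bessel_ser (c * ((s t)\<^sup>2 - x\<^sup>2))"
        by (simp add: observer_gain_def bessel_I1_quot_eq_bessel_ser)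
      have "Tt x t = \<alpha> * Txx x t" "s' t = - \<beta> * Tx (s t) t"
        using sol t x by (simp_all add: stefan_solution_def)
      moreover have "Ut x t = \<alpha> * Uxx x t - observer_gain \<alpha> lam x (s t) * (s' t / \<beta> + Ux (s t) t)"
        using obs t x by (simp add: observer_solution_def)
      ultimately show ?thesis
        using assms(2) by (simp add: ut_def uxx_def ux_def gain algebra_simps)
    qed
    define v where "v \<xi> t = u (\<xi> * s t) t" for \<xi> t
    define v1 where "v1 \<xi> t = s t * ux (\<xi> * s t) t" for \<xi> t
    define v2 where "v2 \<xi> t = (s t)\<^sup>2 * uxx (\<xi> * s t) t" for \<xi> t
    have mem: "\<xi> * s t \<in> {0..s t}" if "\<xi> \<in> {0..1}" "t \<ge> 0" for \<xi> t
      using that s_pos[OF that(2)] by (auto intro: mult_left_le_one_le)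
    have comp: "continuous_on ({0..1} \<times> R) (\<lambda>z. g (fst z * s (snd z)) (snd z))"
      if "continuous_on (moving_domain s \<inter> {(x, t). t \<in> R}) (\<lambda>(x, t). g x t)" "R \<subseteq> {0..}"
      for g :: "real \<Rightarrow> real \<Rightarrow> real" and R
    proof -
      have 1: "continuous_on ({0..1} \<times> R) (\<lambda>z. (fst z * s (snd z), snd z))"
        using continuous_on_snd_arg[OF continuous_on_subset[OF cs that(2)]]
        by (auto intro!: continuous_intros)
      have 2: "(\<lambda>z. (fst z * s (snd z), snd z)) ` ({0..1} \<times> R) \<subseteq> moving_domain s \<inter> {p. snd p \<in> R}"
        using mem that(2) by (fastforce simp: moving_domain_def)
      show ?thesis
        using continuous_on_compose2[OF that(1)[unfolded split_beta] 1 2] by simp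
    qed
    have cv: "continuous_on ({0..1} \<times> {0..}) (\<lambda>(x, t). v x t)"
      unfolding v_def split_beta
      by (rule comp) (use cl in \<open>auto simp: classical_on_def elim: continuous_on_subset\<close>)
    have csx: "continuous_on ({0..1::real} \<times> {0..}) (\<lambda>z. s (snd z))"
      by (rule continuous_on_snd_arg[OF cs])
    have cv1: "continuous_on ({0..1} \<times> {0..}) (\<lambda>(x, t). v1 x t)"
      unfolding v1_def split_beta
      by (rule continuous_on_mult[OF csx comp]) (use cl in \<open>auto simp: classical_on_def elim: continuous_on_subset\<close>)
    have csx': "continuous_on ({0..1::real} \<times> {0<..}) (\<lambda>z. s (snd z))"
      by (rule continuous_on_subset[OF csx]) auto
    have cv2: "continuous_on ({0..1} \<times> {0<..}) (\<lambda>(x, t). v2 x t)"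
      unfolding v2_def split_beta
      by (rule continuous_on_mult[OF continuous_on_power[OF csx'] comp])
        (use cl in \<open>auto simp: classical_on_def\<close>)
    have scale: "((\<lambda>\<xi>. g (\<xi> * s t)) has_real_derivative s t * g') (at \<xi> within {0..1})"
      if "(g has_real_derivative g') (at (\<xi> * s t) within {0..s t})" "t \<ge> 0" for g g' \<xi> t
    proof -
      have "(g has_real_derivative g') (at (\<xi> * s t) within (\<lambda>\<xi>. \<xi> * s t) ` {0..1})"
        by (rule DERIV_subset[OF that(1)]) (use mem that(2) in auto)
      from DERIV_image_chain[OF this DERIV_cmult_right[OF DERIV_ident, of "s t"]]
      show ?thesis by (simp add: o_def mult.commute)
    qed
    have dux: "((\<lambda>y. u y t) has_real_derivative ux x t) (at x within {0..s t})"
      if "t \<ge> 0" "x \<in> {0..s t}" for x t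
      using cl that unfolding classical_on_def by blast
    have duxx: "((\<lambda>y. ux y t) has_real_derivative uxx x t) (at x within {0..s t})"
      if "t > 0" "x \<in> {0..s t}" for x t
      using cl that unfolding classical_on_def by blast
    have dv: "((\<lambda>x. v x t) has_real_derivative v1 x t) (at x within {0..1})"
      if x: "x \<in> {0..1}" and t: "t > 0" for x t
      unfolding v_def v1_def by (rule scale[OF dux[OF _ mem[OF x]]]) (use t in auto)
    have dv1: "((\<lambda>x. v1 x t) has_real_derivative v2 x t) (at x within {0..1})"
      if x: "x \<in> {0..1}" and t: "t > 0" for x t
    proof -
      have "((\<lambda>\<xi>. ux (\<xi> * s t) t) has_real_derivative s t * uxx (x * s t) t) (at x within {0..1})"
        by (rule scale[OF duxx[OF t mem[OF x]]]) (use t in auto)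
      from DERIV_cmult[OF this, of "s t"] show ?thesis
        unfolding v1_def v2_def by (simp add: power2_eq_square mult.assoc)
    qed
    have cs': "continuous_on {0<..} s'"
    proof -
      have "continuous_on {0<..} (\<lambda>t. - \<beta> * Tx (s t) t)"
      proof (intro continuous_on_mult continuous_on_const)
        have "continuous_on (moving_domain s) (\<lambda>(x, t). Tx x t)" using clT by (simp add: classical_on_def)
        from this[unfolded split_beta] show "continuous_on {0<..} (\<lambda>t. Tx (s t) t)"
          by (rule continuous_on_compose2[where f = "\<lambda>t. (s t, t)" and g = "\<lambda>z. Tx (fst z) (snd z)", simplified])
            (use s_pos in \<open>auto simp: moving_domain_def less_imp_le intro!: continuous_intros continuous_on_subset[OF cs]\<close>)
      qed
      moreover have "- \<beta> * Tx (s t) t = s' t" if "t \<in> {0<..}" for t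
        using sol that by (simp add: stefan_solution_def)
      ultimately show ?thesis by (rule continuous_on_eq)
    qed
    define G where "G x t = lam / (c * (s t)\<^sup>2) * v2 x t + x * (s' t / s t) * v1 x t
        + lam * bessel_ser (c * (s t)\<^sup>2 * (1 - x\<^sup>2)) * v1 1 t" for x t
    have cG: "continuous_on ({0..1} \<times> {0<..}) (\<lambda>(x, t). G x t)"
    proof -
      have sp: "\<forall>z\<in>{0..1::real} \<times> {0<..}. s (snd z) \<noteq> 0" using s_pos by (auto simp: less_le)
      have cv1': "continuous_on ({0..1} \<times> {0<..}) (\<lambda>z. v1 (fst z) (snd z))"
        by (rule continuous_on_subset[OF cv1[unfolded split_beta]]) auto
      have tip: "continuous_on ({0..1::real} \<times> {0<..}) (\<lambda>z. v1 1 (snd z))"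
        by (rule continuous_on_snd_arg, rule continuous_on_subset[OF continuous_on_section(1)[OF cv1]]) auto
      show ?thesis
        unfolding G_def split_beta
        using sp c
        by (intro continuous_on_add continuous_on_mult continuous_on_divide continuous_on_const continuous_on_power
            csx' cv2[unfolded split_beta] cv1' tip continuous_on_bessel_ser continuous_on_diff
            continuous_on_fst continuous_on_id continuous_on_snd_arg[OF cs']) auto
    qed
    have dvt: "((\<lambda>t. v x t) has_real_derivative G x t) (at t)" if x: "x \<in> {0..1}" and t: "t > 0" for x t
    proof (rule time_derivative_extends_to_boundary[where S = "{0<..}", OF _ _ _ _ cG _ x])
      show "continuous_on ({0..1} \<times> {0<..}) (\<lambda>(x, t). v x t)"
        by (rule continuous_on_subset[OF cv]) auto
    next
      fix x t :: real assume x: "0 \<le> x" "x < 1" and t: "t \<in> {0<..}"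
      have t': "t > 0" "s t > 0" using t s_pos by auto
      have "((\<lambda>t. v x t) has_real_derivative ux (x * s t) t * (x * s' t) + ut (x * s t) t) (at t)"
        unfolding v_def by (rule moving_chain_rule[OF cl cs ds t' x]) (use t' in simp)
      also have "ux (x * s t) t * (x * s' t) + ut (x * s t) t = G x t"
      proof -
        have "ut (x * s t) t = \<alpha> * uxx (x * s t) t
          + lam * s t * bessel_ser (c * ((s t)\<^sup>2 - (x * s t)\<^sup>2)) * ux (s t) t"
          by (rule pde[OF t'(1) mem]) (use x t' in auto)
        moreover have "c * ((s t)\<^sup>2 - (x * s t)\<^sup>2) = c * (s t)\<^sup>2 * (1 - x\<^sup>2)"
          by (simp add: power_mult_distrib algebra_simps)
        ultimately show ?thesis
          using t' c by (simp add: G_def v1_def v2_def \<alpha>c)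
      qed
      finally show "((\<lambda>t. v x t) has_real_derivative G x t) (at t)" .
    qed (use t in auto)
    have bc1: "v 1 t = 0" if "t > 0" for t
      using sol obs that by (simp add: v_def u_def stefan_solution_def observer_solution_def)
    have bc0: "v1 0 t = 0" if "t > 0" for t
    proof -
      have "- k * Tx 0 t = qc t" "- k * Ux 0 t = qc t"
        using sol obs that by (simp_all add: stefan_solution_def observer_solution_def)
      then have "Tx 0 t = Ux 0 t" using assms(3) by (metis mult_cancel_left neg_equal_0_iff_equal less_irrefl)
      then show ?thesis by (simp add: v1_def ux_def)
    qed
    have norm: "H1_norm_sq (s t) (\<lambda>x. T x t - U x t) = scaled_energy (s t) (\<lambda>x. v x t) (\<lambda>x. v1 x t)"
      if t: "t \<ge> 0" for t
      unfolding v_def v1_def u_def[symmetric]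
    proof (rule H1_norm_sq_rescale[OF s_pos[OF t] dux[OF t]])
      have "continuous_on (moving_domain s) (\<lambda>(x, t). ux x t)" using cl by (simp add: classical_on_def)
      from this[unfolded split_beta] show "continuous_on {0..s t} (\<lambda>x. ux x t)"
        by (rule continuous_on_compose2[where f = "\<lambda>x. (x, t)" and g = "\<lambda>z. ux (fst z) (snd z)", simplified])
          (use t in \<open>auto simp: moving_domain_def intro!: continuous_intros\<close>)
    qed
    have sec: "continuous_on {0..1} (\<lambda>x. v x t)" "continuous_on {0..1} (\<lambda>x. v1 x t)" if "t \<ge> 0" for t
      using continuous_on_section(2)[OF cv, of t] continuous_on_section(2)[OF cv1, of t] that by auto
    let ?E = "\<lambda>t. scaled_energy (s t) (backstep (c * (s t)\<^sup>2) (\<lambda>x. v x t))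
      (backstep1 (c * (s t)\<^sup>2) (\<lambda>x. v x t) (\<lambda>x. v1 x t))"
    let ?N = "\<lambda>t. scaled_energy (s t) (\<lambda>x. v x t) (\<lambda>x. v1 x t)"
    have "?N t \<le> M2 * ?E t" by (rule M2[OF s_pos s_le sec]) (rule t)+
    also have "\<dots> \<le> M2 * (exp (- 2 * lam * t) * ?E 0)"
      using scaled_error_system_decay[OF c assms(5) s_pos cs ds cs' s'_nonneg cv cv1 cv2 dv dv1
          dvt[unfolded G_def] bc1 bc0 t] M(2)
      by (intro mult_left_mono) auto
    also have "\<dots> \<le> M2 * (exp (- 2 * lam * t) * (M1 * ?N 0))"
      using M1[OF s_pos[OF order_refl] s_le[OF order_refl] sec[OF order_refl]] M(2) by (intro mult_left_mono) auto
    finally show "H1_norm_sq (s t) (\<lambda>x. T x t - U x t)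
        \<le> M2 * M1 * exp (- (2 * lam) * t) * H1_norm_sq (s 0) (\<lambda>x. T x 0 - U x 0)"
      unfolding norm[OF t] norm[OF order_refl] by (simp add: mult_ac)
  qed
qed

end
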